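(* Let $H$ and $K$ be separable Hilbert spaces. If a family of bounded operators $\{T_i\}_{i\in I}$ on $H$ is a resolution of the identity operator on $H$ and a family of bounded operators $\{U_j\}_{j\in J}$ on $K$ is a resolution of the identity operator on $K$, then $\{T_i\otimes U_j\}_{(i,j)\in I\times J}$ is a resolution of the identity operator on $H\otimes K$.
   Context: $H\otimes K$ is the Hilbert space tensor product, with $\langle f\otimes g,f'\otimes g'\rangle=\langle f,f'\rangle\langle g,g'\rangle$. For bounded operators $Q$ on $H$ and $T$ on $K$, $Q\otimes T$ is the bounded operator on $H\otimes K$ with $(Q\otimes T)(f\otimes g)=Qf\otimes Tg$. A family of bounded operators $\{T_i\}_{i\in I}$ on $H$ is a resolution of the identity operator on $H$ if for all $f\in H$, $f=\sum_{i\in I}T_i(f)$, with the series converging unconditionally (similarly for $K$). A family of bounded operators $\{T_i\otimes U_j\}_{i,j}$ on $H\otimes K$ is a resolution of the identity operator on $H\otimes K$ if for all $f\otimes g\in H\otimes K$ (i.e. for all $f\in H$, $g\in K$), $f\otimes g=\sum_{i,j}(T_i\otimes U_j)(f\otimes g)$, with the series converging unconditionally. *)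

theory Defs
  imports "HOL-Analysis.Analysis"
begin

text \<open>
  Scalar fields for Hilbert spaces. The two axioms force the field to be a copy of the reals
  (with trivial conjugation) or of the complex numbers (with complex conjugation): fixed points of
  the conjugation are real, so every \<open>x\<close> is a root of the real quadratic with coefficients
  \<open>x + scalar_cnj x\<close> and \<open>x * scalar_cnj x\<close>.
\<close>

class hilbert_scalar = real_normed_field +
  fixes scalar_cnj :: "'a \<Rightarrow> 'a"
  assumes scalar_cnj_add: "scalar_cnj (x + y) = scalar_cnj x + scalar_cnj y"
    and mult_scalar_cnj: "x * scalar_cnj x = (norm x)\<^sup>2 *\<^sub>R 1"

instantiation real :: hilbert_scalar
begin
definition scalar_cnj_real :: "real \<Rightarrow> real" where "scalar_cnj_real x = x"
instance by standard (simp_all add: scalar_cnj_real_def power2_eq_square)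
end

instantiation complex :: hilbert_scalar
begin
definition scalar_cnj_complex :: "complex \<Rightarrow> complex" where "scalar_cnj_complex = cnj"
instance
  by standard
    (simp_all add: scalar_cnj_complex_def scaleR_conv_of_real complex_norm_square [symmetric]
      del: of_real_power)
end

text \<open>
  The class \<^class>\<open>banach\<close> supplies norm, topology and completeness; the locale adds the scalar
  action and an inner product inducing that norm. Positive definiteness is part of
  \<open>inner_self\<close>, since the norm is positive definite.
\<close>

locale hilbert_space = vector_space scale
  for scale :: "'s::hilbert_scalar \<Rightarrow> 'h::banach \<Rightarrow> 'h" +
  fixes inner_prod :: "'h \<Rightarrow> 'h \<Rightarrow> 's"
  assumes scale_of_real: "scale (of_real r) x = r *\<^sub>R x"
    and inner_add_left: "inner_prod (x + y) z = inner_prod x z + inner_prod y z"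
    and inner_scale_left: "inner_prod (scale c x) y = c * inner_prod x y"
    and inner_commute: "inner_prod x y = scalar_cnj (inner_prod y x)"
    and inner_self: "inner_prod x x = of_real ((norm x)\<^sup>2)"

lemma hilbert_space_real_inner:
  "hilbert_space scaleR (inner :: 'h::{real_inner,banach} \<Rightarrow> 'h \<Rightarrow> real)"
  by unfold_locales
    (simp_all add: scalar_cnj_real_def inner_add_right inner_commute power2_norm_eq_inner
      scaleR_add_right scaleR_add_left)

definition bounded_operator ::
  "('s::field \<Rightarrow> 'h::real_normed_vector \<Rightarrow> 'h) \<Rightarrow> ('h \<Rightarrow> 'h) \<Rightarrow> bool" where
  "bounded_operator scl Q \<longleftrightarrow>
    Vector_Spaces.linear scl scl Q \<and> (\<exists>C. \<forall>x. norm (Q x) \<le> C * norm x)"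

text \<open>
  A Hilbert space tensor product of \<open>H\<close> and \<open>K\<close> is a Hilbert space \<open>HK\<close> with a bilinear map
  whose values have the product inner products and span a dense subspace. This determines
  \<open>HK\<close> and \<open>tensor\<close> up to a unique unitary isomorphism.
\<close>

locale hilbert_tensor_product =
  H: hilbert_space scaleH innerH + K: hilbert_space scaleK innerK +
  HK: hilbert_space scaleHK innerHK
  for scaleH :: "'s::hilbert_scalar \<Rightarrow> 'h::banach \<Rightarrow> 'h" and innerH :: "'h \<Rightarrow> 'h \<Rightarrow> 's"
    and scaleK :: "'s \<Rightarrow> 'k::banach \<Rightarrow> 'k" and innerK :: "'k \<Rightarrow> 'k \<Rightarrow> 's"
    and scaleHK :: "'s \<Rightarrow> 'hk::banach \<Rightarrow> 'hk" and innerHK :: "'hk \<Rightarrow> 'hk \<Rightarrow> 's" +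
  fixes tensor :: "'h \<Rightarrow> 'k \<Rightarrow> 'hk"
  assumes tensor_add_left: "tensor (f + f') g = tensor f g + tensor f' g"
    and tensor_add_right: "tensor f (g + g') = tensor f g + tensor f g'"
    and tensor_scale_left: "tensor (scaleH c f) g = scaleHK c (tensor f g)"
    and tensor_scale_right: "tensor f (scaleK c g) = scaleHK c (tensor f g)"
    and inner_tensor: "innerHK (tensor f g) (tensor f' g') = innerH f f' * innerK g g'"
    and dense_tensor: "closure (HK.span {tensor f g |f g. True}) = UNIV"

definition tensor_op ::
  "('s::field \<Rightarrow> 'hk::real_normed_vector \<Rightarrow> 'hk) \<Rightarrow> ('h \<Rightarrow> 'k \<Rightarrow> 'hk) \<Rightarrow>
    ('h \<Rightarrow> 'h) \<Rightarrow> ('k \<Rightarrow> 'k) \<Rightarrow> 'hk \<Rightarrow> 'hk" where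
  "tensor_op scaleHK tensor Q T =
    (THE S. bounded_operator scaleHK S \<and> (\<forall>f g. S (tensor f g) = tensor (Q f) (T g)))"

text \<open>
  Unconditional convergence of a series is convergence of the net of its finite partial sums,
  which is what \<open>has_sum\<close> expresses.
\<close>

definition resolution_of_identity ::
  "('s::field \<Rightarrow> 'h::real_normed_vector \<Rightarrow> 'h) \<Rightarrow> 'i set \<Rightarrow> ('i \<Rightarrow> 'h \<Rightarrow> 'h) \<Rightarrow> bool" where
  "resolution_of_identity scl I T \<longleftrightarrow>
    (\<forall>i\<in>I. bounded_operator scl (T i)) \<and> (\<forall>f. ((\<lambda>i. T i f) has_sum f) I)"

text \<open>On the tensor product the expansion is required for simple tensors only.\<close>

definition tensor_resolution_of_identity ::
  "('s::field \<Rightarrow> 'hk::real_normed_vector \<Rightarrow> 'hk) \<Rightarrow> ('h \<Rightarrow> 'k \<Rightarrow> 'hk) \<Rightarrow>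
    'a set \<Rightarrow> ('a \<Rightarrow> 'hk \<Rightarrow> 'hk) \<Rightarrow> bool" where
  "tensor_resolution_of_identity scaleHK tensor A V \<longleftrightarrow>
    (\<forall>a\<in>A. bounded_operator scaleHK (V a)) \<and>
    (\<forall>f g. ((\<lambda>a. V a (tensor f g)) has_sum tensor f g) A)"

end

theory Submission
  imports Defs
begin

text \<open>
  The operators \<open>Q \<otimes> T\<close> exist because \<open>\<Sum>k. Q f\<^sub>k \<otimes> g\<^sub>k\<close> has norm at most \<open>\<parallel>Q\<parallel>\<close> times that of
  \<open>\<Sum>k. f\<^sub>k \<otimes> g\<^sub>k\<close>, as one sees by expanding the \<open>g\<^sub>k\<close> in an orthonormal basis of their span.

  Convergence over \<open>I \<times> J\<close> is the difficulty: finite subsets of \<open>I \<times> J\<close> need not be rectangles, so the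
  product of two unconditionally convergent series does not converge unconditionally for purely formal
  reasons. What is needed is that \<open>\<parallel>\<Sum>(i,j)\<in>G. x\<^sub>i \<otimes> y\<^sub>j\<parallel> \<le> C a b\<close> for all finite \<open>G \<subseteq> F \<times> E\<close>, where \<open>a\<close> and
  \<open>b\<close> bound the norms of the subsums of \<open>x\<close> over \<open>F\<close> and of \<open>y\<close> over \<open>E\<close>. The sum is \<open>\<Sum>i. x\<^sub>i \<otimes> z\<^sub>i\<close> with
  \<open>\<parallel>z\<^sub>i\<parallel> \<le> b\<close>, so the estimate is the little Grothendieck inequality for the \<open>x\<^sub>i\<close>. To prove that, replace
  the \<open>z\<^sub>i\<close> by Rademacher sums and truncate them: the bounded parts contribute \<open>O(a)\<close>, while the
  remainders have small second moment (by a fourth moment bound) and are absorbed into the best constant.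
\<close>

subsection \<open>Scalars and Rademacher sums\<close>

lemma scalar_cnj_zero [simp]: "scalar_cnj (0::'s::hilbert_scalar) = 0"
  using scalar_cnj_add[of 0 "0::'s"] by simp

text \<open>The axioms give only additivity and the value of \<open>x * scalar_cnj x\<close>. From
  this quotient form, multiplicativity, fixed real scalars and isometry follow by field
  arithmetic.\<close>

lemma scalar_cnj_eq_divide:
  "x \<noteq> 0 \<Longrightarrow> scalar_cnj x = of_real ((norm x)\<^sup>2) / (x::'s::hilbert_scalar)"
  using mult_scalar_cnj[of x] by (simp add: field_simps scaleR_conv_of_real)

lemma scalar_cnj_mult: "scalar_cnj (x * y) = scalar_cnj x * scalar_cnj (y::'s::hilbert_scalar)"
  by (cases "x = 0 \<or> y = 0") (auto simp: scalar_cnj_eq_divide norm_mult power_mult_distrib)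

lemma scalar_cnj_of_real [simp]: "scalar_cnj (of_real r :: 's::hilbert_scalar) = of_real r"
  by (cases "r = 0") (auto simp: scalar_cnj_eq_divide power2_eq_square)

lemma norm_scalar_cnj [simp]: "norm (scalar_cnj x) = norm (x::'s::hilbert_scalar)"
  by (cases "x = 0") (auto simp: scalar_cnj_eq_divide norm_divide norm_mult power2_eq_square)

lemma scalar_cnj_diff: "scalar_cnj (x - y) = scalar_cnj x - scalar_cnj (y::'s::hilbert_scalar)"
  using scalar_cnj_add[of "x - y" y] by simp

lemma scalar_cnj_sum: "scalar_cnj (sum f A) = (\<Sum>i\<in>A. scalar_cnj (f i :: 's::hilbert_scalar))"
  by (induction A rule: infinite_finite_induct) (auto simp: scalar_cnj_add)

text \<open>Lets the moment bounds for Rademacher sums apply to scalar coefficients as well as to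
  vectors.\<close>

lemma scalar_parallelogram:
  fixes x y :: "'s::hilbert_scalar"
  shows "(norm (x + y))\<^sup>2 + (norm (x - y))\<^sup>2 = 2 * (norm x)\<^sup>2 + 2 * (norm y)\<^sup>2"
proof -
  have "of_real ((norm z)\<^sup>2) = z * scalar_cnj z" for z :: 's
    by (simp add: mult_scalar_cnj scaleR_conv_of_real)
  then have "(of_real ((norm (x + y))\<^sup>2 + (norm (x - y))\<^sup>2) :: 's)
      = of_real (2 * (norm x)\<^sup>2 + 2 * (norm y)\<^sup>2)"
    by (simp add: scalar_cnj_add scalar_cnj_diff algebra_simps del: of_real_power)
  then show ?thesis
    by (simp only: of_real_eq_iff)
qed

text \<open>Every scalar is a root of a real quadratic with nonpositive discriminant, so non-real scalars
  differ from their real parts by real multiples of one square root \<open>j\<close> of \<open>-1\<close>.\<close>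

lemma scalar_real_imag_parts:
  obtains j :: "'s::hilbert_scalar" where "norm j \<le> 1"
    "\<forall>c. \<exists>\<alpha> \<beta>. c = of_real \<alpha> + of_real \<beta> * j \<and> \<bar>\<alpha>\<bar> \<le> norm c \<and> \<bar>\<beta>\<bar> \<le> norm c"
proof -
  have quad: "\<exists>\<rho> s. \<bar>\<rho>\<bar> \<le> norm c \<and> 0 \<le> s \<and> s \<le> norm c \<and>
      (c - of_real \<rho>)\<^sup>2 = - ((of_real s)\<^sup>2)" for c :: 's
  proof -
    \<comment> \<open>The real part of \<open>c\<close>, recovered from norms: expanding the square
      of \<open>norm (c + 1)\<close> shows that \<open>2 * \<rho>\<close> is
      \<open>c + scalar_cnj c\<close>.\<close>
    define \<rho> where "\<rho> = ((norm (c + 1))\<^sup>2 - (norm c)\<^sup>2 - 1) / 2"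
    have cnj1: "scalar_cnj (1::'s) = 1"
      using scalar_cnj_of_real[of 1] by simp
    have n2: "of_real ((norm z)\<^sup>2) = z * scalar_cnj z" for z :: 's
      by (simp add: mult_scalar_cnj scaleR_conv_of_real)
    have "(of_real (2 * \<rho>) :: 's) = of_real ((norm (c + 1))\<^sup>2) - of_real ((norm c)\<^sup>2) - 1"
      by (simp add: \<rho>_def)
    also have "\<dots> = c + scalar_cnj c"
      unfolding n2 by (simp add: scalar_cnj_add cnj1 algebra_simps)
    finally have \<rho>: "of_real (2 * \<rho>) = c + scalar_cnj c" .
    have "norm (of_real (2 * \<rho>) :: 's) \<le> norm c + norm c"
      unfolding \<rho> by (rule order_trans[OF norm_triangle_ineq]) simp
    then have le: "\<bar>\<rho>\<bar> \<le> norm c"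
      by (simp only: norm_of_real)
    then have sq: "\<rho>\<^sup>2 \<le> (norm c)\<^sup>2"
      by (metis abs_ge_zero power2_abs power_mono)
    \<comment> \<open>\<open>s\<close> plays the absolute value of the imaginary part of
      \<open>c\<close>.\<close>
    define s where "s = sqrt ((norm c)\<^sup>2 - \<rho>\<^sup>2)"
    have s: "s\<^sup>2 = (norm c)\<^sup>2 - \<rho>\<^sup>2" "0 \<le> s"
      using sq by (auto simp: s_def)
    have "s \<le> norm c"
      by (rule power2_le_imp_le) (auto simp: s)
    moreover have "(c - of_real \<rho>)\<^sup>2 = - ((of_real s)\<^sup>2)"
    proof -
      have "(of_real s)\<^sup>2 = (of_real (s\<^sup>2) :: 's)"
        by simp
      also have "\<dots> = c * scalar_cnj c - (of_real \<rho>)\<^sup>2"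
        unfolding s by (simp add: n2 del: of_real_power) simp
      also have "scalar_cnj c = 2 * of_real \<rho> - c"
        using \<rho> by (simp add: algebra_simps)
      finally show ?thesis
        by (simp add: power2_eq_square algebra_simps)
    qed
    ultimately show ?thesis
      using le s(2) by blast
  qed
  show thesis
  proof (cases "\<exists>c::'s. \<forall>\<rho>. c \<noteq> of_real \<rho>")
    case True
    then obtain c :: 's where c: "\<And>\<rho>. c \<noteq> of_real \<rho>"
      by blast
    obtain \<rho> s where s: "0 \<le> s" "(c - of_real \<rho>)\<^sup>2 = - ((of_real s)\<^sup>2)"
      using quad by blast
    have "s \<noteq> 0"
      using s(2) c[of \<rho>] by auto
    \<comment> \<open>Normalising the imaginary part of a single non-real scalar gives a square root
      of -1.\<close>
    define j where "j = (c - of_real \<rho>) / of_real s"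
    have j2: "j\<^sup>2 = -1"
      using s(2) \<open>s \<noteq> 0\<close> by (simp add: j_def power_divide)
    then have "(norm j)\<^sup>2 = 1"
      by (metis norm_minus_cancel norm_one norm_power)
    then have "norm j \<le> 1"
      by (simp add: power2_eq_1_iff) (smt (verit) norm_ge_zero)
    moreover have "\<exists>\<alpha> \<beta>. d = of_real \<alpha> + of_real \<beta> * j \<and> \<bar>\<alpha>\<bar> \<le> norm d \<and> \<bar>\<beta>\<bar> \<le> norm d" for d
    proof -
      obtain \<alpha> r where r: "\<bar>\<alpha>\<bar> \<le> norm d" "0 \<le> r" "r \<le> norm d"
          "(d - of_real \<alpha>)\<^sup>2 = - ((of_real r)\<^sup>2)"
        using quad by blast
      then have "(d - of_real \<alpha>)\<^sup>2 = (of_real r * j)\<^sup>2"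
        by (simp add: power_mult_distrib j2)
      \<comment> \<open>Elements of a field with equal squares agree up to sign, and the sign is
        absorbed by the real coefficient of \<open>j\<close>.\<close>
      then have "d - of_real \<alpha> = of_real r * j \<or> d - of_real \<alpha> = - (of_real r * j)"
        by (simp add: power2_eq_iff)
      then have "d = of_real \<alpha> + of_real r * j \<or> d = of_real \<alpha> + of_real (- r) * j"
        by (auto simp: algebra_simps)
      then show ?thesis
        using r by (metis abs_minus_cancel abs_of_nonneg)
    qed
    ultimately show ?thesis
      using that by blast
  next
    case False
    \<comment> \<open>All scalars are real here, so \<open>j = 0\<close> serves.\<close>
    then have "\<exists>\<alpha> \<beta>. c = of_real \<alpha> + of_real \<beta> * 0 \<and> \<bar>\<alpha>\<bar> \<le> norm c \<and> \<bar>\<beta>\<bar> \<le> norm c" for c :: 's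
      by (intro exI[of _ "SOME \<rho>. c = of_real \<rho>"] exI[of _ 0])
        (metis (mono_tags, lifting) abs_zero add.right_neutral mult_zero_right norm_ge_zero
          norm_of_real order_refl someI_ex)
    then show ?thesis
      using that[of 0] by simp
  qed
qed

text \<open>The sum of the vectors \<open>v k\<close> with signs \<open>+\<close> for \<open>k \<in> \<omega>\<close> and \<open>-\<close> otherwise; averaging over
  \<open>\<omega> \<in> Pow N\<close> is the expectation over independent Rademacher signs.\<close>

definition signed_sum :: "'k set \<Rightarrow> ('k \<Rightarrow> 'a::real_normed_vector) \<Rightarrow> 'k set \<Rightarrow> 'a" where
  "signed_sum N v \<omega> = (\<Sum>k\<in>N. if k \<in> \<omega> then v k else - v k)"

section \<open>Second and fourth moments of Rademacher sums\<close>

lemma sum_Pow_insert: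
  assumes "finite N" "a \<notin> N"
  shows "(\<Sum>\<omega>\<in>Pow (insert a N). g \<omega>) = (\<Sum>\<omega>\<in>Pow N. g \<omega> + g (insert a \<omega>))"
proof -
  have "inj_on (insert a) (Pow N)"
    using assms(2) by (auto simp: inj_on_def)
  then have "(\<Sum>\<omega>\<in>insert a ` Pow N. g \<omega>) = (\<Sum>\<omega>\<in>Pow N. g (insert a \<omega>))"
    by (simp add: sum.reindex)
  moreover have "Pow N \<inter> insert a ` Pow N = {}"
    using assms(2) by auto
  ultimately show ?thesis
    using assms(1) by (simp add: Pow_insert sum.union_disjoint sum.distrib)
qed

lemma signed_sum_insert:
  assumes "finite N" "a \<notin> N" "\<omega> \<in> Pow N"
  shows "signed_sum (insert a N) v \<omega> = signed_sum N v \<omega> - v a"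
    and "signed_sum (insert a N) v (insert a \<omega>) = signed_sum N v \<omega> + v a"
proof -
  have "a \<notin> \<omega>" "(\<Sum>k\<in>N. if k \<in> insert a \<omega> then v k else - v k) = signed_sum N v \<omega>"
    using assms by (auto simp: signed_sum_def intro!: sum.cong)
  then show "signed_sum (insert a N) v \<omega> = signed_sum N v \<omega> - v a"
    and "signed_sum (insert a N) v (insert a \<omega>) = signed_sum N v \<omega> + v a"
    using assms by (auto simp: signed_sum_def)
qed

text \<open>Averaging over the sign of one term removes its cross terms by the parallelogram
  identity. That identity is a hypothesis so that the result covers both scalars and Hilbert space
  vectors.\<close>

lemma sum_norm_signed_sum_power2:
  fixes v :: "'k \<Rightarrow> 'a::real_normed_vector"
  assumes par: "\<And>x y::'a. (norm (x + y))\<^sup>2 + (norm (x - y))\<^sup>2 = 2 * (norm x)\<^sup>2 + 2 * (norm y)\<^sup>2"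
    and "finite N"
  shows "(\<Sum>\<omega>\<in>Pow N. (norm (signed_sum N v \<omega>))\<^sup>2) = 2 ^ card N * (\<Sum>k\<in>N. (norm (v k))\<^sup>2)"
  using \<open>finite N\<close>
proof induction
  case empty
  then show ?case by (simp add: signed_sum_def)
next
  case (insert a N)
  have "(\<Sum>\<omega>\<in>Pow (insert a N). (norm (signed_sum (insert a N) v \<omega>))\<^sup>2)
      = (\<Sum>\<omega>\<in>Pow N. 2 * (norm (signed_sum N v \<omega>))\<^sup>2 + 2 * (norm (v a))\<^sup>2)"
    unfolding sum_Pow_insert[OF insert.hyps]
    by (rule sum.cong) (simp_all add: signed_sum_insert[OF insert.hyps] flip: par)
  also have "\<dots> = 2 ^ card (insert a N) * (\<Sum>k\<in>insert a N. (norm (v k))\<^sup>2)"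
    using insert by (simp add: sum.distrib card_Pow algebra_simps flip: sum_distrib_left)
  finally show ?case .
qed

text \<open>With \<open>p\<close> and \<open>q\<close> the two norms on the left, twice the sum of
  fourth powers is the square of \<open>p\<^sup>2 + q\<^sup>2\<close>, known exactly, plus the
  square of \<open>p\<^sup>2 - q\<^sup>2\<close>. The latter is small because \<bar>p - q\<bar> is
  at most twice the smaller of the norms of \<open>x\<close> and \<open>y\<close>.\<close>

lemma parallelogram_power4_le:
  fixes x y :: "'a::real_normed_vector"
  assumes par: "(norm (x + y))\<^sup>2 + (norm (x - y))\<^sup>2 = 2 * (norm x)\<^sup>2 + 2 * (norm y)\<^sup>2"
  shows "norm (x + y) ^ 4 + norm (x - y) ^ 4
    \<le> 2 * norm x ^ 4 + 20 * (norm x)\<^sup>2 * (norm y)\<^sup>2 + 2 * norm y ^ 4"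
proof -
  define p q A B where "p = norm (x + y)" and "q = norm (x - y)" and "A = norm x" and "B = norm y"
  have pq: "p\<^sup>2 + q\<^sup>2 = 2 * A\<^sup>2 + 2 * B\<^sup>2"
    using par by (simp add: p_def q_def A_def B_def)
  have "\<bar>p - q\<bar> \<le> norm ((x + y) - (x - y))"
    unfolding p_def q_def by (rule norm_triangle_ineq3)
  also have "\<dots> = 2 * B"
    by (simp add: B_def flip: scaleR_2)
  finally have b: "(p - q)\<^sup>2 \<le> 4 * B\<^sup>2"
    using power_mono[of "\<bar>p - q\<bar>" "2 * B" 2] by (simp add: power_mult_distrib)
  have "\<bar>norm (x + y) - norm (y - x)\<bar> \<le> norm ((x + y) - (y - x))"
    by (rule norm_triangle_ineq3)
  also have "\<dots> = 2 * A"
    by (simp add: A_def flip: scaleR_2)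
  finally have "\<bar>p - q\<bar> \<le> 2 * A"
    by (simp add: p_def q_def norm_minus_commute)
  then have a: "(p - q)\<^sup>2 \<le> 4 * A\<^sup>2"
    using power_mono[of "\<bar>p - q\<bar>" "2 * A" 2] by (simp add: power_mult_distrib)
  have sum: "(p + q)\<^sup>2 \<le> 4 * (A\<^sup>2 + B\<^sup>2)"
    using pq sum_squares_bound[of p q] by (simp add: power2_sum)
  have "(p\<^sup>2 - q\<^sup>2)\<^sup>2 = (p - q)\<^sup>2 * (p + q)\<^sup>2"
    by (simp add: power2_eq_square algebra_simps)
  also have "\<dots> \<le> (p - q)\<^sup>2 * (4 * (A\<^sup>2 + B\<^sup>2))"
    by (intro mult_left_mono sum) simp
  also have "\<dots> = 4 * ((p - q)\<^sup>2 * A\<^sup>2 + (p - q)\<^sup>2 * B\<^sup>2)"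
    by (simp add: algebra_simps)
  \<comment> \<open>Each summand uses the bound on \<open>(p - q)\<^sup>2\<close> by the other norm,
    leaving only mixed terms.\<close>
  also have "\<dots> \<le> 4 * ((4 * B\<^sup>2) * A\<^sup>2 + (4 * A\<^sup>2) * B\<^sup>2)"
    by (intro mult_left_mono add_mono mult_right_mono a b) auto
  finally have diff: "(p\<^sup>2 - q\<^sup>2)\<^sup>2 \<le> 32 * (A\<^sup>2 * B\<^sup>2)"
    by (simp add: algebra_simps)
  have "2 * (p ^ 4 + q ^ 4) = (p\<^sup>2 + q\<^sup>2)\<^sup>2 + (p\<^sup>2 - q\<^sup>2)\<^sup>2"
    by (simp add: power2_eq_square power4_eq_xxxx algebra_simps)
  also have "\<dots> \<le> (2 * A\<^sup>2 + 2 * B\<^sup>2)\<^sup>2 + 32 * (A\<^sup>2 * B\<^sup>2)"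
    using diff pq by simp
  also have "\<dots> = 2 * (2 * A ^ 4 + 20 * A\<^sup>2 * B\<^sup>2 + 2 * B ^ 4)"
    by (simp add: power2_eq_square power4_eq_xxxx algebra_simps)
  finally show ?thesis
    unfolding p_def q_def A_def B_def by simp
qed

text \<open>The constant 5 closes the induction: the cross term \<open>10 * s * \<beta>\<close> is
  exactly the one in \<open>5 * (\<beta> + s)\<^sup>2\<close>.\<close>

lemma sum_norm_signed_sum_power4_le:
  fixes v :: "'k \<Rightarrow> 'a::real_normed_vector"
  assumes par: "\<And>x y::'a. (norm (x + y))\<^sup>2 + (norm (x - y))\<^sup>2 = 2 * (norm x)\<^sup>2 + 2 * (norm y)\<^sup>2"
    and "finite N"
  shows "(\<Sum>\<omega>\<in>Pow N. norm (signed_sum N v \<omega>) ^ 4) \<le> 2 ^ card N * (5 * (\<Sum>k\<in>N. (norm (v k))\<^sup>2)\<^sup>2)"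
  using \<open>finite N\<close>
proof induction
  case empty
  then show ?case by (simp add: signed_sum_def)
next
  case (insert a N)
  define s \<beta> where "s = (\<Sum>k\<in>N. (norm (v k))\<^sup>2)" and "\<beta> = (norm (v a))\<^sup>2"
  have s\<beta>: "0 \<le> s" "0 \<le> \<beta>"
    by (auto simp: s_def \<beta>_def intro: sum_nonneg)
  have "(\<Sum>\<omega>\<in>Pow (insert a N). norm (signed_sum (insert a N) v \<omega>) ^ 4)
      \<le> (\<Sum>\<omega>\<in>Pow N. 2 * norm (signed_sum N v \<omega>) ^ 4 + 20 * \<beta> * (norm (signed_sum N v \<omega>))\<^sup>2 + 2 * \<beta>\<^sup>2)"
    unfolding sum_Pow_insert[OF insert.hyps]
    using parallelogram_power4_le[OF par, of "signed_sum N v _" "v a"]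
    by (intro sum_mono) (simp add: signed_sum_insert[OF insert.hyps] \<beta>_def algebra_simps)
  also have "\<dots> = 2 * (\<Sum>\<omega>\<in>Pow N. norm (signed_sum N v \<omega>) ^ 4)
      + 20 * \<beta> * (2 ^ card N * s) + 2 * (2 ^ card N * \<beta>\<^sup>2)"
    unfolding s_def
    by (simp add: sum.distrib card_Pow insert.hyps sum_norm_signed_sum_power2[OF par, symmetric]
        flip: sum_distrib_left)
  also have "\<dots> \<le> 2 * (2 ^ card N * (5 * s\<^sup>2)) + 20 * \<beta> * (2 ^ card N * s) + 2 * (2 ^ card N * \<beta>\<^sup>2)"
    using insert.IH by (simp add: s_def)
  also have "\<dots> = 2 * 2 ^ card N * (5 * s\<^sup>2 + 10 * s * \<beta> + \<beta>\<^sup>2)"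
    by (simp add: algebra_simps)
  also have "\<dots> \<le> 2 * 2 ^ card N * (5 * (\<beta> + s)\<^sup>2)"
    using s\<beta> by (intro mult_left_mono) (auto simp: power2_sum)
  finally show ?case
    using insert.hyps by (simp add: s_def \<beta>_def)
qed

text \<open>The vector is affine in each multiplier, so by convexity its norm is bounded by the
  values at the vertices of the cube, which are the subsums. The offset \<open>v\<close> carries the
  terms already decided in the induction.\<close>

lemma norm_convex_multipliers_le:
  fixes x :: "'i \<Rightarrow> 'a::real_normed_vector"
  assumes "finite F" "\<And>i. i \<in> F \<Longrightarrow> 0 \<le> t i \<and> t i \<le> 1"
    and "\<And>A. A \<subseteq> F \<Longrightarrow> norm (v + sum x A) \<le> M"
  shows "norm (v + (\<Sum>i\<in>F. t i *\<^sub>R x i)) \<le> M"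
  using assms
proof (induction arbitrary: v)
  case empty
  from empty(2)[of "{}"] show ?case by simp
next
  case (insert a F)
  have fin: "finite A" if "A \<subseteq> F" for A
    using that insert.hyps(1) finite_subset by blast
  have 0: "norm (v + (\<Sum>i\<in>F. t i *\<^sub>R x i)) \<le> M"
    using insert.prems by (intro insert.IH) (auto intro: subset_insertI2)
  have 1: "norm ((v + x a) + (\<Sum>i\<in>F. t i *\<^sub>R x i)) \<le> M"
  proof (rule insert.IH)
    fix A assume "A \<subseteq> F"
    then have "sum x (insert a A) = x a + sum x A"
      using insert.hyps fin by (intro sum.insert) auto
    then show "norm (v + x a + sum x A) \<le> M"
      using insert.prems(2)[of "insert a A"] \<open>A \<subseteq> F\<close> by (auto simp: add.assoc)
  qed (use insert.prems in auto)
  let ?w = "\<Sum>i\<in>F. t i *\<^sub>R x i"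
  have t: "0 \<le> t a" "t a \<le> 1"
    using insert.prems by auto
  have "v + (\<Sum>i\<in>insert a F. t i *\<^sub>R x i) = (1 - t a) *\<^sub>R (v + ?w) + t a *\<^sub>R (v + x a + ?w)"
    using insert.hyps by (simp add: algebra_simps)
  also have "norm \<dots> \<le> (1 - t a) * M + t a * M"
    using t by (intro order_trans[OF norm_triangle_ineq] add_mono)
      (auto intro!: mult_left_mono 0 1)
  finally show ?case
    by (simp add: algebra_simps)
qed

text \<open>Positive and negative parts of the multipliers lie in the unit interval; each costs one
  \<open>M\<close>.\<close>

lemma norm_bounded_multipliers_le:
  fixes x :: "'i \<Rightarrow> 'a::real_normed_vector"
  assumes "finite F" "\<And>i. i \<in> F \<Longrightarrow> \<bar>t i\<bar> \<le> 1" and "\<And>A. A \<subseteq> F \<Longrightarrow> norm (sum x A) \<le> M"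
  shows "norm (\<Sum>i\<in>F. t i *\<^sub>R x i) \<le> 2 * M"
proof -
  have "norm (0 + (\<Sum>i\<in>F. max 0 (t i) *\<^sub>R x i)) \<le> M" "norm (0 + (\<Sum>i\<in>F. max 0 (- t i) *\<^sub>R x i)) \<le> M"
    using assms by (intro norm_convex_multipliers_le; fastforce)+
  moreover have "(\<Sum>i\<in>F. t i *\<^sub>R x i) = (\<Sum>i\<in>F. max 0 (t i) *\<^sub>R x i) - (\<Sum>i\<in>F. max 0 (- t i) *\<^sub>R x i)"
    unfolding sum_subtractf[symmetric] scaleR_diff_left[symmetric] by (rule sum.cong) auto
  ultimately show ?thesis
    using norm_triangle_ineq4 by (smt (verit) add_0)
qed

subsection \<open>The little Grothendieck inequality\<close>

text \<open>A crude bound depending on \<open>card F\<close>; it serves only to make the supremum in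
  \<open>little_Grothendieck\<close> finite.\<close>

lemma sum_norm_weights_power2_le:
  fixes w :: "'i \<Rightarrow> 'n \<Rightarrow> real"
  assumes w: "\<And>i. i \<in> F \<Longrightarrow> (\<Sum>n\<in>N. (w i n)\<^sup>2) \<le> 1"
  shows "(\<Sum>n\<in>N. (\<Sum>i\<in>F. w i n * y i)\<^sup>2) \<le> real (card F) * (\<Sum>i\<in>F. (y i)\<^sup>2)"
proof -
  have "(\<Sum>n\<in>N. (\<Sum>i\<in>F. w i n * y i)\<^sup>2) \<le> (\<Sum>n\<in>N. (\<Sum>i\<in>F. (w i n)\<^sup>2) * (\<Sum>i\<in>F. (y i)\<^sup>2))"
    by (intro sum_mono Cauchy_Schwarz_ineq_sum)
  also have "\<dots> = (\<Sum>i\<in>F. \<Sum>n\<in>N. (w i n)\<^sup>2) * (\<Sum>i\<in>F. (y i)\<^sup>2)"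
    by (subst sum.swap) (simp add: sum_distrib_right)
  also have "\<dots> \<le> real (card F) * (\<Sum>i\<in>F. (y i)\<^sup>2)"
    using sum_bounded_above[of F "\<lambda>i. \<Sum>n\<in>N. (w i n)\<^sup>2" 1] w
    by (intro mult_right_mono) (auto intro: sum_nonneg)
  finally show ?thesis .
qed

lemma norm_add_power2_le:
  fixes x y :: "'a::real_normed_vector"
  shows "(norm (x + y))\<^sup>2 \<le> 2 * (norm x)\<^sup>2 + 2 * (norm y)\<^sup>2"
proof -
  have "(norm (x + y))\<^sup>2 \<le> (norm x + norm y)\<^sup>2"
    by (intro power_mono norm_triangle_ineq) simp
  also have "\<dots> \<le> 2 * (norm x)\<^sup>2 + 2 * (norm y)\<^sup>2"
    using sum_squares_bound[of "norm x" "norm y"] by (simp add: power2_sum)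
  finally show ?thesis .
qed

section \<open>Hilbert space geometry and the inequality for vectors\<close>

context hilbert_space
begin

lemma inner_sum_left: "inner_prod (sum v A) y = (\<Sum>k\<in>A. inner_prod (v k) y)"
proof (induction A rule: infinite_finite_induct)
  case (insert a A)
  then show ?case by (simp add: inner_add_left)
qed (use inner_scale_left[of 0] in auto)

lemma inner_sum_right: "inner_prod y (sum v A) = (\<Sum>k\<in>A. inner_prod y (v k))"
  by (subst inner_commute) (simp add: inner_sum_left scalar_cnj_sum flip: inner_commute)

lemma inner_add_right: "inner_prod z (x + y) = inner_prod z x + inner_prod z y"
  by (metis inner_add_left inner_commute scalar_cnj_add)

lemma inner_diff_left: "inner_prod (x - y) z = inner_prod x z - inner_prod y z"
  using inner_add_left[of "x - y" y z] by simp

lemma inner_diff_right: "inner_prod z (x - y) = inner_prod z x - inner_prod z y"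
  using inner_add_right[of z "x - y" y] by simp

lemma inner_scale_right: "inner_prod x (scale c y) = scalar_cnj c * inner_prod x y"
  by (metis inner_scale_left inner_commute scalar_cnj_mult)

lemma norm_scale: "norm (scale c x) = norm c * norm x"
proof -
  have "of_real ((norm (scale c x))\<^sup>2) = (c * scalar_cnj c) * inner_prod x x"
    unfolding inner_self[symmetric] by (simp add: inner_scale_left inner_scale_right)
  also have "\<dots> = of_real ((norm c * norm x)\<^sup>2)"
    by (simp add: mult_scalar_cnj inner_self scaleR_conv_of_real power_mult_distrib)
  finally have "(norm (scale c x))\<^sup>2 = (norm c * norm x)\<^sup>2"
    by (simp only: of_real_eq_iff)
  then show ?thesis
    by (simp add: power2_eq_iff_nonneg)
qed

lemma scaleR_scale: "r *\<^sub>R scale c x = scale (r *\<^sub>R c) x"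
  by (simp add: scaleR_conv_of_real flip: scale_of_real)

lemma bounded_linear_scale: "bounded_linear (scale c)"
proof (rule bounded_linear_intro[of _ "norm c"])
  fix r x
  show "scale c (r *\<^sub>R x) = r *\<^sub>R scale c x"
    by (simp add: mult.commute flip: scale_of_real)
qed (auto simp: scale_right_distrib norm_scale)

lemma parallelogram_law:
  fixes x y :: 'h
  shows "(norm (x + y))\<^sup>2 + (norm (x - y))\<^sup>2 = 2 * (norm x)\<^sup>2 + 2 * (norm y)\<^sup>2"
proof -
  have "(of_real ((norm (x + y))\<^sup>2 + (norm (x - y))\<^sup>2) :: 's)
      = inner_prod (x + y) (x + y) + inner_prod (x - y) (x - y)"
    by (simp add: inner_self)
  also have "\<dots> = 2 * inner_prod x x + 2 * inner_prod y y"
    by (simp add: inner_add_left inner_add_right inner_diff_left inner_diff_right)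
  also have "\<dots> = of_real (2 * (norm x)\<^sup>2 + 2 * (norm y)\<^sup>2)"
    by (simp add: inner_self)
  finally show ?thesis
    by (simp only: of_real_eq_iff)
qed

lemma norm_sum_orthogonal:
  assumes "finite A" "\<And>k l. k \<in> A \<Longrightarrow> l \<in> A \<Longrightarrow> k \<noteq> l \<Longrightarrow> inner_prod (v k) (v l) = 0"
  shows "(norm (sum v A))\<^sup>2 = (\<Sum>k\<in>A. (norm (v k))\<^sup>2)"
proof -
  have "(of_real ((norm (sum v A))\<^sup>2) :: 's) = (\<Sum>k\<in>A. \<Sum>l\<in>A. inner_prod (v k) (v l))"
    unfolding inner_self[symmetric] inner_sum_left inner_sum_right by (rule sum.swap)
  also have "\<dots> = (\<Sum>k\<in>A. \<Sum>l\<in>A. if l = k then inner_prod (v k) (v k) else 0)"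
    using assms(2) by (intro sum.cong) auto
  also have "\<dots> = of_real (\<Sum>k\<in>A. (norm (v k))\<^sup>2)"
    using assms(1) by (simp add: inner_self)
  finally show ?thesis
    by (simp only: of_real_eq_iff)
qed

definition orthonormal :: "nat \<Rightarrow> (nat \<Rightarrow> 'h) \<Rightarrow> bool" where
  "orthonormal n e \<longleftrightarrow> (\<forall>k<n. \<forall>l<n. inner_prod (e k) (e l) = (if k = l then 1 else 0))"

lemma norm_orthonormal:
  assumes "orthonormal n e" "k < n"
  shows "norm (e k) = 1"
proof -
  have "(of_real ((norm (e k))\<^sup>2) :: 's) = of_real 1"
    unfolding inner_self[symmetric] using assms by (simp add: orthonormal_def)
  then have "(norm (e k))\<^sup>2 = 1"
    by (simp only: of_real_eq_iff)
  then show ?thesis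
    by (simp add: power2_eq_1_iff) (smt (verit) norm_ge_zero)
qed

lemma norm_sum_orthonormal:
  assumes "orthonormal n e"
  shows "(norm (\<Sum>k<n. scale (c k) (e k)))\<^sup>2 = (\<Sum>k<n. (norm (c k))\<^sup>2)"
  using assms norm_orthonormal[OF assms]
  by (subst norm_sum_orthogonal)
    (auto simp: inner_scale_left inner_scale_right orthonormal_def norm_scale)

lemma inner_eq_zero_commute: "inner_prod x y = 0 \<Longrightarrow> inner_prod y x = 0"
  using inner_commute[of y x] by simp

text \<open>Gram-Schmidt: the residual \<open>b\<close> of the new vector is orthogonal to the
  family so far; it is either zero or normalised and appended.\<close>

lemma orthonormal_expansion_exists:
  assumes "finite S"
  obtains n e where "orthonormal n e" "\<And>s. s \<in> S \<Longrightarrow> s = (\<Sum>k<n. scale (inner_prod s (e k)) (e k))"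
  using assms
proof (induction S arbitrary: thesis)
  case empty
  show ?case
    by (rule empty(1)[of 0 "\<lambda>_. 0"]) (auto simp: orthonormal_def)
next
  case (insert a S)
  obtain n e where on: "orthonormal n e"
    and ex: "\<And>s. s \<in> S \<Longrightarrow> s = (\<Sum>k<n. scale (inner_prod s (e k)) (e k))"
    using insert.IH by blast
  define b where "b = a - (\<Sum>k<n. scale (inner_prod a (e k)) (e k))"
  have orth: "inner_prod (\<Sum>k<n. scale (c k) (e k)) (e l) = c l" if "l < n" for c l
  proof -
    have "inner_prod (\<Sum>k<n. scale (c k) (e k)) (e l) = (\<Sum>k<n. if k = l then c k else 0)"
      unfolding inner_sum_left inner_scale_left
      using on that by (intro sum.cong) (auto simp: orthonormal_def)
    then show ?thesis
      using that by simp
  qed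
  have b0: "inner_prod b (e l) = 0" if "l < n" for l
    using orth[OF that] by (simp add: b_def inner_diff_left)
  show ?case
  proof (cases "b = 0")
    case True
    then have "a = (\<Sum>k<n. scale (inner_prod a (e k)) (e k))"
      by (simp add: b_def)
    with insert.prems on ex show ?thesis
      by blast
  next
    case False
    define u where "u = scale (of_real (1 / norm b)) b"
    define e' where "e' = e(n := u)"
    have uu: "inner_prod u u = 1"
      using False by (simp add: inner_self u_def norm_scale norm_divide)
    have ue: "inner_prod u (e l) = 0" "inner_prod (e l) u = 0" if "l < n" for l
      using b0[OF that] inner_eq_zero_commute by (auto simp: u_def inner_scale_left)
    have bu: "scale (inner_prod b u) u = b"
      using False
      by (simp add: u_def inner_scale_right inner_self power2_eq_square flip: of_real_mult of_real_divide)
    have on': "orthonormal (Suc n) e'"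
      using on uu ue by (auto simp: orthonormal_def e'_def less_Suc_eq)
    have "s = (\<Sum>k<Suc n. scale (inner_prod s (e' k)) (e' k))" if "s \<in> insert a S" for s
    proof -
      have eq: "(\<Sum>k<Suc n. scale (inner_prod s (e' k)) (e' k))
          = (\<Sum>k<n. scale (inner_prod s (e k)) (e k)) + scale (inner_prod s u) u"
        by (simp add: e'_def)
      \<comment> \<open>Old vectors have no component along \<open>u\<close>, so their expansions
        are unchanged.\<close>
      have z: "inner_prod (\<Sum>k<n. scale (c k) (e k)) u = 0" for c
        by (simp add: inner_sum_left inner_scale_left ue)
      show ?thesis
      proof (cases "s = a")
        case True
        have "a = (\<Sum>k<n. scale (inner_prod a (e k)) (e k)) + b"
          by (simp add: b_def)
        moreover from this have "inner_prod a u = inner_prod b u"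
          by (metis inner_add_left z add_0)
        ultimately show ?thesis
          using eq bu True by simp
      next
        case False
        then have s: "s = (\<Sum>k<n. scale (inner_prod s (e k)) (e k))"
          using ex that by blast
        then have "inner_prod s u = 0"
          by (metis z)
        then show ?thesis
          using eq s by simp
      qed
    qed
    with insert.prems on' show ?thesis
      by blast
  qed
qed

text \<open>The real coefficients of 1 and \<open>j\<close> are bounded by 1 in absolute value, so
  each part costs \<open>2 * M\<close>.\<close>

lemma norm_scalar_multipliers_le:
  assumes "finite F" "\<And>A. A \<subseteq> F \<Longrightarrow> norm (sum x A) \<le> M" "\<And>i. i \<in> F \<Longrightarrow> norm (c i) \<le> 1"
  shows "norm (\<Sum>i\<in>F. scale (c i) (x i)) \<le> 4 * M"
proof -
  obtain j :: 's where j: "norm j \<le> 1"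
    and "\<forall>c. \<exists>\<alpha> \<beta>. c = of_real \<alpha> + of_real \<beta> * j \<and> \<bar>\<alpha>\<bar> \<le> norm c \<and> \<bar>\<beta>\<bar> \<le> norm c"
    by (rule scalar_real_imag_parts)
  then obtain \<alpha> \<beta> where dec: "\<And>c. c = of_real (\<alpha> c) + of_real (\<beta> c) * j"
    and le: "\<And>c. \<bar>\<alpha> c\<bar> \<le> norm c" "\<And>c. \<bar>\<beta> c\<bar> \<le> norm c"
    by metis
  have "scale d y = \<alpha> d *\<^sub>R y + scale j (\<beta> d *\<^sub>R y)" for d y
  proof -
    have "scale d y = scale (of_real (\<alpha> d) + j * of_real (\<beta> d)) y"
      using dec[of d] by (metis mult.commute)
    then show ?thesis
      by (simp add: scale_left_distrib flip: scale_of_real)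
  qed
  then have "(\<Sum>i\<in>F. scale (c i) (x i)) = (\<Sum>i\<in>F. \<alpha> (c i) *\<^sub>R x i + scale j (\<beta> (c i) *\<^sub>R x i))"
    by (intro sum.cong refl)
  also have "\<dots> = (\<Sum>i\<in>F. \<alpha> (c i) *\<^sub>R x i) + scale j (\<Sum>i\<in>F. \<beta> (c i) *\<^sub>R x i)"
    by (simp only: sum.distrib scale_sum_right)
  also have "norm \<dots> \<le> norm (\<Sum>i\<in>F. \<alpha> (c i) *\<^sub>R x i) + 1 * norm (\<Sum>i\<in>F. \<beta> (c i) *\<^sub>R x i)"
    by (intro order_trans[OF norm_triangle_ineq] add_left_mono)
      (auto simp: norm_scale intro: mult_right_mono j[simplified] mult_left_le_one_le)
  also have "\<dots> \<le> 2 * M + 1 * (2 * M)"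
    using assms order_trans[OF le(1)] order_trans[OF le(2)]
    by (intro add_mono mult_left_mono norm_bounded_multipliers_le) auto
  finally show ?thesis
    by simp
qed

text \<open>Truncating the Rademacher sums \<open>\<Sum>k. \<plusminus> w i k\<close> at \<open>t\<close> with \<open>t\<^sup>2 = 20\<close>: the bounded part is controlled
  by \<open>a\<close>, and the remainder has second moment at most \<open>5 / t\<^sup>2 = 1 / 4\<close>.\<close>

lemma little_Grothendieck_step:
  fixes x :: "'i \<Rightarrow> 'h" and w :: "'i \<Rightarrow> nat \<Rightarrow> 's"
  assumes F: "finite F"
    and a: "\<And>c. (\<And>i. i \<in> F \<Longrightarrow> norm (c i) \<le> 1) \<Longrightarrow> norm (\<Sum>i\<in>F. scale (c i) (x i)) \<le> a"
    and q: "\<And>(N::nat set) w. finite N \<Longrightarrow> (\<And>i. i \<in> F \<Longrightarrow> (\<Sum>n\<in>N. (norm (w i n))\<^sup>2) \<le> 1) \<Longrightarrow>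
      (\<Sum>n\<in>N. (norm (\<Sum>i\<in>F. scale (w i n) (x i)))\<^sup>2) \<le> q"
    and N: "finite N" and w: "\<And>i. i \<in> F \<Longrightarrow> (\<Sum>n\<in>N. (norm (w i n))\<^sup>2) \<le> 1"
  shows "(\<Sum>n\<in>N. (norm (\<Sum>i\<in>F. scale (w i n) (x i)))\<^sup>2) \<le> 40 * a\<^sup>2 + q / 2"
proof -
  define p :: real where "p = 2 ^ card N"
  have p: "p > 0"
    by (simp add: p_def)
  define t :: real where "t = sqrt 20"
  have t: "t > 0" "t\<^sup>2 = 20"
    by (auto simp: t_def)
  define Z where "Z = (\<lambda>i \<omega>. signed_sum N (w i) \<omega>)"
  define Z1 where "Z1 = (\<lambda>i \<omega>. if norm (Z i \<omega>) \<le> t then Z i \<omega> else 0)"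
  define Z2 where "Z2 = (\<lambda>i \<omega>. if norm (Z i \<omega>) \<le> t then 0 else Z i \<omega>)"
  have Z12: "Z i \<omega> = Z1 i \<omega> + Z2 i \<omega>" for i \<omega>
    by (simp add: Z1_def Z2_def)
  have "norm (\<Sum>i\<in>F. scale (Z1 i \<omega>) (x i)) \<le> t * a" for \<omega>
  proof -
    have "norm (\<Sum>i\<in>F. scale ((1 / t) *\<^sub>R Z1 i \<omega>) (x i)) \<le> a"
      using t by (intro a) (auto simp: Z1_def)
    moreover have "(\<Sum>i\<in>F. scale ((1 / t) *\<^sub>R Z1 i \<omega>) (x i)) = (1 / t) *\<^sub>R (\<Sum>i\<in>F. scale (Z1 i \<omega>) (x i))"
      by (simp add: scaleR_scale scaleR_sum_right)
    ultimately show ?thesis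
      using t by (simp add: field_simps)
  qed
  then have bdd: "(norm (\<Sum>i\<in>F. scale (Z1 i \<omega>) (x i)))\<^sup>2 \<le> 20 * a\<^sup>2" for \<omega>
    using power_mono[of "norm (\<Sum>i\<in>F. scale (Z1 i \<omega>) (x i))" "t * a" 2] t
    by (simp add: power_mult_distrib)
  have small: "(\<Sum>\<omega>\<in>Pow N. (norm (Z2 i \<omega>))\<^sup>2) \<le> p / 4" if "i \<in> F" for i
  proof -
    have "(norm (Z2 i \<omega>))\<^sup>2 \<le> norm (Z i \<omega>) ^ 4 / 20" for \<omega>
    proof (cases "norm (Z i \<omega>) \<le> t")
      case False
      then have "t\<^sup>2 \<le> (norm (Z i \<omega>))\<^sup>2"
        using t by (intro power_mono) auto
      then have "20 * (norm (Z i \<omega>))\<^sup>2 \<le> (norm (Z i \<omega>))\<^sup>2 * (norm (Z i \<omega>))\<^sup>2"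
        using t by (intro mult_right_mono) auto
      then show ?thesis
        using False by (simp add: Z2_def flip: power_add)
    qed (simp add: Z2_def)
    then have "(\<Sum>\<omega>\<in>Pow N. (norm (Z2 i \<omega>))\<^sup>2) \<le> (\<Sum>\<omega>\<in>Pow N. norm (Z i \<omega>) ^ 4 / 20)"
      by (intro sum_mono)
    also have "\<dots> \<le> (p * (5 * (\<Sum>k\<in>N. (norm (w i k))\<^sup>2)\<^sup>2)) / 20"
      unfolding sum_divide_distrib[symmetric] Z_def p_def
      by (intro divide_right_mono sum_norm_signed_sum_power4_le scalar_parallelogram N) simp
    also have "\<dots> \<le> (p * (5 * 1\<^sup>2)) / 20"
      using p w[OF that]
      by (intro divide_right_mono mult_left_mono power_mono) (auto intro: sum_nonneg)
    finally show ?thesis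
      by simp
  qed
  have rest: "(\<Sum>\<omega>\<in>Pow N. (norm (\<Sum>i\<in>F. scale (Z2 i \<omega>) (x i)))\<^sup>2) \<le> p * q / 4"
  proof -
    \<comment> \<open>The remainders have second moment sum at most \<open>p / 4\<close>, so scaling
      by \<open>r\<close> makes them admissible weights and the hypothesis on \<open>q\<close> can
      be reapplied.\<close>
    define r where "r = 2 / sqrt p"
    have r: "r\<^sup>2 = 4 / p"
      using p by (simp add: r_def power_divide)
    \<comment> \<open>Admissible weights are indexed by naturals, so the sign patterns are coded by
      \<open>set_encode\<close>.\<close>
    define w' where "w' = (\<lambda>i n. r *\<^sub>R Z2 i (set_decode n))"
    have inj: "inj_on set_encode (Pow N)"
      by (rule inj_on_subset[OF inj_on_set_encode]) (use N finite_subset in auto)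
    have fin: "finite \<omega>" if "\<omega> \<in> Pow N" for \<omega>
      using that N finite_subset by auto
    have "(\<Sum>n\<in>set_encode ` Pow N. (norm (\<Sum>i\<in>F. scale (w' i n) (x i)))\<^sup>2) \<le> q"
    proof (rule q)
      fix i assume i: "i \<in> F"
      have "(\<Sum>n\<in>set_encode ` Pow N. (norm (w' i n))\<^sup>2) = (\<Sum>\<omega>\<in>Pow N. r\<^sup>2 * (norm (Z2 i \<omega>))\<^sup>2)"
        unfolding sum.reindex[OF inj]
        by (rule sum.cong) (simp_all add: w'_def fin power_mult_distrib)
      also have "\<dots> \<le> 1"
        unfolding sum_distrib_left[symmetric] r using small[OF i] p by (simp add: field_simps)
      finally show "(\<Sum>n\<in>set_encode ` Pow N. (norm (w' i n))\<^sup>2) \<le> 1" .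
    qed (use N in simp)
    also have "(\<Sum>n\<in>set_encode ` Pow N. (norm (\<Sum>i\<in>F. scale (w' i n) (x i)))\<^sup>2)
        = (\<Sum>\<omega>\<in>Pow N. r\<^sup>2 * (norm (\<Sum>i\<in>F. scale (Z2 i \<omega>) (x i)))\<^sup>2)"
      unfolding sum.reindex[OF inj]
      by (rule sum.cong)
        (simp_all add: w'_def fin power_mult_distrib flip: scaleR_scale scaleR_sum_right)
    finally show ?thesis
      unfolding sum_distrib_left[symmetric] r using p by (simp add: field_simps)
  qed
  define v where "v = (\<lambda>n. \<Sum>i\<in>F. scale (w i n) (x i))"
  have sv: "signed_sum N v \<omega> = (\<Sum>i\<in>F. scale (Z i \<omega>) (x i))" for \<omega>
  proof -
    have "signed_sum N v \<omega> = (\<Sum>n\<in>N. \<Sum>i\<in>F. scale (if n \<in> \<omega> then w i n else - w i n) (x i))"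
      unfolding signed_sum_def v_def by (intro sum.cong) (auto simp: sum_negf)
    also have "\<dots> = (\<Sum>i\<in>F. scale (Z i \<omega>) (x i))"
      by (subst sum.swap) (simp add: Z_def signed_sum_def scale_sum_left)
    finally show ?thesis .
  qed
  \<comment> \<open>The sum of squares becomes a second moment over signs, and by \<open>sv\<close>
    the signed sum of \<open>v\<close> has the scalar Rademacher sums \<open>Z i\<close> as
    coefficients.\<close>
  have "p * (\<Sum>n\<in>N. (norm (v n))\<^sup>2) = (\<Sum>\<omega>\<in>Pow N. (norm (signed_sum N v \<omega>))\<^sup>2)"
    unfolding p_def by (rule sum_norm_signed_sum_power2[symmetric, OF parallelogram_law N])
  \<comment> \<open>Squaring the sum of the two parts costs a factor 2: the truncated part gives
    \<open>40 * a\<^sup>2\<close>, the remainder \<open>q / 2\<close>.\<close>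
  also have "\<dots> \<le> (\<Sum>\<omega>\<in>Pow N. 2 * (20 * a\<^sup>2) + 2 * (norm (\<Sum>i\<in>F. scale (Z2 i \<omega>) (x i)))\<^sup>2)"
  proof (rule sum_mono)
    fix \<omega>
    have "signed_sum N v \<omega> = (\<Sum>i\<in>F. scale (Z1 i \<omega>) (x i)) + (\<Sum>i\<in>F. scale (Z2 i \<omega>) (x i))"
      unfolding sv Z12 by (simp add: scale_left_distrib sum.distrib)
    then show "(norm (signed_sum N v \<omega>))\<^sup>2
        \<le> 2 * (20 * a\<^sup>2) + 2 * (norm (\<Sum>i\<in>F. scale (Z2 i \<omega>) (x i)))\<^sup>2"
      using norm_add_power2_le[of "\<Sum>i\<in>F. scale (Z1 i \<omega>) (x i)" "\<Sum>i\<in>F. scale (Z2 i \<omega>) (x i)"]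
        bdd[of \<omega>] by simp
  qed
  also have "\<dots> \<le> p * (40 * a\<^sup>2) + 2 * (p * q / 4)"
    using rest N by (simp add: sum.distrib card_Pow p_def mult.commute flip: sum_distrib_left)
  finally have "p * (\<Sum>n\<in>N. (norm (v n))\<^sup>2) \<le> p * (40 * a\<^sup>2 + q / 2)"
    by (simp add: algebra_simps)
  then show ?thesis
    using p by (simp add: v_def)
qed

text \<open>Let \<open>q\<close> be the best constant for fixed \<open>x\<close> and
  \<open>F\<close> over all admissible weights. The step gives
  \<open>q \<le> 40 * a\<^sup>2 + q / 2\<close>, and finiteness of \<open>q\<close> allows the
  absorption.\<close>

lemma little_Grothendieck:
  fixes x :: "'i \<Rightarrow> 'h" and w :: "'i \<Rightarrow> nat \<Rightarrow> 's"
  assumes F: "finite F"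
    and a: "\<And>c. (\<And>i. i \<in> F \<Longrightarrow> norm (c i) \<le> 1) \<Longrightarrow> norm (\<Sum>i\<in>F. scale (c i) (x i)) \<le> a"
    and N: "finite N" and w: "\<And>i. i \<in> F \<Longrightarrow> (\<Sum>n\<in>N. (norm (w i n))\<^sup>2) \<le> 1"
  shows "(\<Sum>n\<in>N. (norm (\<Sum>i\<in>F. scale (w i n) (x i)))\<^sup>2) \<le> 80 * a\<^sup>2"
proof -
  define V where "V = {(N::nat set, w::'i \<Rightarrow> nat \<Rightarrow> 's). finite N \<and>
      (\<forall>i\<in>F. (\<Sum>n\<in>N. (norm (w i n))\<^sup>2) \<le> 1)}"
  define E where "E = (\<lambda>(N::nat set, w). \<Sum>n\<in>N. (norm (\<Sum>i\<in>F. scale (w i n) (x i)))\<^sup>2)"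
  define q where "q = (SUP z\<in>V. E z)"
  have "E z \<le> real (card F) * (\<Sum>i\<in>F. (norm (x i))\<^sup>2)" if z: "z \<in> V" for z
  proof -
    obtain N w where [simp]: "z = (N, w)"
      by fastforce
    have "E z \<le> (\<Sum>n\<in>N. (\<Sum>i\<in>F. norm (w i n) * norm (x i))\<^sup>2)"
      unfolding E_def by (auto simp flip: norm_scale intro!: sum_mono power_mono norm_sum)
    also have "\<dots> \<le> real (card F) * (\<Sum>i\<in>F. (norm (x i))\<^sup>2)"
      using z by (intro sum_norm_weights_power2_le) (auto simp: V_def)
    finally show ?thesis .
  qed
  then have "bdd_above (E ` V)"
    by (auto intro!: bdd_aboveI2)
  then have q: "E z \<le> q" if "z \<in> V" for z
    unfolding q_def using that by (intro cSUP_upper)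
  have "E z \<le> 40 * a\<^sup>2 + q / 2" if "z \<in> V" for z
    using that little_Grothendieck_step[OF F a, of q "fst z" "snd z"] q[of "(_, _)"]
    by (auto simp: V_def E_def)
  moreover have "V \<noteq> {}"
    by (auto simp: V_def intro!: exI[of _ "{}"])
  ultimately have "q \<le> 40 * a\<^sup>2 + q / 2"
    unfolding q_def by (intro cSUP_least)
  moreover have "E (N, w) \<le> q"
    using N w by (intro q) (auto simp: V_def)
  ultimately show ?thesis
    by (simp add: E_def)
qed

end

subsection \<open>Tensor products of operators\<close>

lemma bounded_operatorD:
  assumes "bounded_operator scl Q"
  shows "Q (x + y) = Q x + Q y" and "Q (scl c x) = scl c (Q x)"
  using assms by (auto simp: bounded_operator_def Vector_Spaces.linear_iff)

lemma bounded_operator_sum: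
  assumes "bounded_operator scl Q"
  shows "Q (sum x A) = (\<Sum>i\<in>A. Q (x i))"
proof -
  have "Q 0 = 0"
    using bounded_operatorD(1)[OF assms, of 0 0] by simp
  then show ?thesis
    by (induction A rule: infinite_finite_induct) (auto simp: bounded_operatorD(1)[OF assms])
qed

lemma bounded_operator_bound:
  assumes "bounded_operator scl Q"
  obtains C where "0 \<le> C" "\<And>x. norm (Q x) \<le> C * norm x"
proof -
  obtain C where C: "\<And>x. norm (Q x) \<le> C * norm x"
    using assms by (auto simp: bounded_operator_def)
  \<comment> \<open>The definition leaves the sign of \<open>C\<close> open.\<close>
  have "norm (Q x) \<le> max 0 C * norm x" for x
    by (rule order_trans[OF C]) (auto intro: mult_right_mono)
  then show ?thesis
    using that[of "max 0 C"] by simp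
qed

section \<open>Extension of bounded operators by density\<close>

context hilbert_space
begin

lemma bounded_operator_bounded_linear:
  assumes "bounded_operator scale Q"
  shows "bounded_linear Q"
proof -
  obtain C where "\<And>x. norm (Q x) \<le> C * norm x"
    using bounded_operator_bound[OF assms] by blast
  then show ?thesis
    using bounded_operatorD[OF assms]
    by (intro bounded_linear_intro[of _ C]) (auto simp: mult.commute simp flip: scale_of_real)
qed

text \<open>The closure of the graph \<open>R\<close> of a bounded densely defined operator is the graph of the extension.\<close>

lemma bounded_operator_extension:
  fixes R :: "('h \<times> 'h) set"
  assumes add: "\<And>u v u' v'. (u, v) \<in> R \<Longrightarrow> (u', v') \<in> R \<Longrightarrow> (u + u', v + v') \<in> R"
    and scl: "\<And>c u v. (u, v) \<in> R \<Longrightarrow> (scale c u, scale c v) \<in> R"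
    and bound: "\<And>u v. (u, v) \<in> R \<Longrightarrow> norm v \<le> C * norm u"
    and dense: "closure (fst ` R) = UNIV"
  obtains S where "bounded_operator scale S" "\<And>u v. (u, v) \<in> R \<Longrightarrow> S u = v"
proof -
  have seq: "z \<in> closure R \<longleftrightarrow> (\<exists>r. (\<forall>n. r n \<in> R) \<and> r \<longlonglongrightarrow> z)" for z
    by (rule closure_sequential)
  have addc: "(u + u', v + v') \<in> closure R" if uv: "(u, v) \<in> closure R" "(u', v') \<in> closure R" for u v u' v'
  proof -
    obtain r r' where r: "\<And>n. r n \<in> R" "r \<longlonglongrightarrow> (u, v)" "\<And>n. r' n \<in> R" "r' \<longlonglongrightarrow> (u', v')"
      using uv by (auto simp: seq)
    have "r n + r' n \<in> R" for n
      using r(1)[of n] r(3)[of n] add by (cases "r n"; cases "r' n") auto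
    moreover have "(\<lambda>n. r n + r' n) \<longlonglongrightarrow> (u, v) + (u', v')"
      by (intro tendsto_add r)
    ultimately show ?thesis
      unfolding seq by (intro exI[of _ "\<lambda>n. r n + r' n"]) auto
  qed
  have sclc: "(scale c u, scale c v) \<in> closure R" if uv: "(u, v) \<in> closure R" for c u v
  proof -
    obtain r where r: "\<And>n. r n \<in> R" "r \<longlonglongrightarrow> (u, v)"
      using uv by (auto simp: seq)
    have "(scale c (fst (r n)), scale c (snd (r n))) \<in> R" for n
      using r(1)[of n] scl by (cases "r n") auto
    moreover have "(\<lambda>n. (scale c (fst (r n)), scale c (snd (r n)))) \<longlonglongrightarrow> (scale c u, scale c v)"
      using tendsto_fst[OF r(2)] tendsto_snd[OF r(2)]
      by (auto intro!: tendsto_Pair bounded_linear.tendsto[OF bounded_linear_scale])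
    ultimately show ?thesis
      unfolding seq by (intro exI[of _ "\<lambda>n. (scale c (fst (r n)), scale c (snd (r n)))"]) auto
  qed
  have boundc: "norm v \<le> C * norm u" if uv: "(u, v) \<in> closure R" for u v
  proof -
    obtain r where r: "\<And>n. r n \<in> R" "r \<longlonglongrightarrow> (u, v)"
      using uv by (auto simp: seq)
    have "norm (snd (r n)) \<le> C * norm (fst (r n))" for n
      using r(1)[of n] bound by (cases "r n") auto
    then show ?thesis
      using tendsto_fst[OF r(2)] tendsto_snd[OF r(2)]
      by (intro LIMSEQ_le[of "\<lambda>n. norm (snd (r n))" _ "\<lambda>n. C * norm (fst (r n))"])
        (auto intro!: tendsto_intros)
  qed
  have diffc: "(u - u', v - v') \<in> closure R" if "(u, v) \<in> closure R" "(u', v') \<in> closure R" for u v u' v'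
    using addc[OF that(1) sclc[OF that(2), of "- 1"]] by simp
  \<comment> \<open>The bound applied to the difference of two pairs over the same \<open>u\<close>
    forces equal images.\<close>
  have unique: "v = v'" if "(u, v) \<in> closure R" "(u, v') \<in> closure R" for u v v'
    using boundc[OF diffc[OF that]] by simp
  have total: "\<exists>v. (u, v) \<in> closure R" for u
  proof -
    have "u \<in> closure (fst ` R)"
      by (simp add: dense)
    then obtain s where s: "\<And>n. s n \<in> fst ` R" "s \<longlonglongrightarrow> u"
      unfolding closure_sequential by blast
    then have "\<forall>n. \<exists>v. (s n, v) \<in> R"
      by force
    then obtain v where v: "\<And>n. (s n, v n) \<in> R"
      by metis
    have vb: "norm (v m - v n) \<le> C * norm (s m - s n)" for m n
      using v closure_subset by (intro boundc diffc) auto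
    have "Cauchy s"
      using s(2) by (intro LIMSEQ_imp_Cauchy)
    have "Cauchy v"
    proof (rule CauchyI)
      fix e :: real assume "e > 0"
      \<comment> \<open>Adding 1 keeps the divisor positive for every real \<open>C\<close>.\<close>
      then have "e / (\<bar>C\<bar> + 1) > 0"
        by simp
      then obtain M where M: "\<And>m n. m \<ge> M \<Longrightarrow> n \<ge> M \<Longrightarrow> norm (s m - s n) < e / (\<bar>C\<bar> + 1)"
        using CauchyD[OF \<open>Cauchy s\<close>] by blast
      have "norm (v m - v n) < e" if "m \<ge> M" "n \<ge> M" for m n
      proof -
        have "norm (v m - v n) \<le> (\<bar>C\<bar> + 1) * norm (s m - s n)"
          by (rule order_trans[OF vb]) (auto intro: mult_right_mono)
        also have "\<dots> < e"
          using M[OF that] by (simp add: field_simps)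
        finally show ?thesis .
      qed
      then show "\<exists>M. \<forall>m\<ge>M. \<forall>n\<ge>M. norm (v m - v n) < e"
        by blast
    qed
    then obtain l where "v \<longlonglongrightarrow> l"
      using Cauchy_convergent convergent_def by blast
    with s(2) have "(\<lambda>n. (s n, v n)) \<longlonglongrightarrow> (u, l)"
      by (intro tendsto_Pair)
    with v show ?thesis
      unfolding seq by (intro exI[of _ l] exI[of _ "\<lambda>n. (s n, v n)"]) auto
  qed
  then obtain S where S: "\<And>u. (u, S u) \<in> closure R"
    by metis
  have "bounded_operator scale S"
    unfolding bounded_operator_def Vector_Spaces.linear_iff
    using unique[OF S addc[OF S S]] unique[OF S sclc[OF S]] boundc[OF S] vector_space_axioms by blast
  moreover have "S u = v" if "(u, v) \<in> R" for u v
    using that closure_subset by (intro unique[OF S]) auto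
  ultimately show ?thesis
    using that by blast
qed

end

section \<open>Existence and uniqueness of the tensor product of two operators\<close>

context hilbert_tensor_product
begin

lemma tensor_sum_left: "tensor (sum f A) g = (\<Sum>k\<in>A. tensor (f k) g)"
  using tensor_scale_left[of 0]
  by (induction A rule: infinite_finite_induct) (auto simp: tensor_add_left)

lemma tensor_sum_right: "tensor f (sum g A) = (\<Sum>k\<in>A. tensor f (g k))"
  using tensor_scale_right[of _ 0]
  by (induction A rule: infinite_finite_induct) (auto simp: tensor_add_right)

lemma tensor_diff_left: "tensor (f - f') g = tensor f g - tensor f' g"
  using tensor_add_left[of "f - f'" f' g] by simp

lemma tensor_diff_right: "tensor f (g - g') = tensor f g - tensor f g'"
  using tensor_add_right[of f "g - g'" g'] by simp

lemma norm_tensor: "norm (tensor f g) = norm f * norm g"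
proof -
  have "(of_real ((norm (tensor f g))\<^sup>2) :: 's) = of_real ((norm f * norm g)\<^sup>2)"
    using inner_tensor[of f g f g]
    by (simp add: HK.inner_self H.inner_self K.inner_self power_mult_distrib)
  then have "(norm (tensor f g))\<^sup>2 = (norm f * norm g)\<^sup>2"
    by (simp only: of_real_eq_iff)
  then show ?thesis
    by (simp add: power2_eq_iff_nonneg)
qed

text \<open>Transfers estimates for an operator on the left factor to the right factor.\<close>

lemma hilbert_tensor_product_swap:
  "hilbert_tensor_product scaleK innerK scaleH innerH scaleHK innerHK (\<lambda>g f. tensor f g)"
proof unfold_locales
  have "{tensor f g |g f. True} = {tensor f g |f g. True}"
    by blast
  then show "closure (HK.span {tensor f g |g f. True}) = UNIV"
    by (simp only: dense_tensor)
qed (simp_all add: tensor_add_left tensor_add_right tensor_scale_left tensor_scale_right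
    inner_tensor mult.commute)

lemma norm_sum_tensor_orthonormal:
  assumes "K.orthonormal n e"
  shows "(norm (\<Sum>k<n. tensor (h k) (e k)))\<^sup>2 = (\<Sum>k<n. (norm (h k))\<^sup>2)"
  using assms K.norm_orthonormal[OF assms]
  by (subst HK.norm_sum_orthogonal) (auto simp: inner_tensor K.orthonormal_def norm_tensor)

text \<open>Bilinearity moves the coefficients of the \<open>g i\<close> to the left; exchanging
  sums collects the coordinate along each \<open>e k\<close>.\<close>

lemma sum_tensor_eq_orthonormal:
  assumes "\<And>i. i \<in> A \<Longrightarrow> g i = (\<Sum>k<n. scaleK (c i k) (e k))"
  shows "(\<Sum>i\<in>A. tensor (f i) (g i)) = (\<Sum>k<n. tensor (\<Sum>i\<in>A. scaleH (c i k) (f i)) (e k))"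
proof -
  have "(\<Sum>i\<in>A. tensor (f i) (g i)) = (\<Sum>i\<in>A. \<Sum>k<n. tensor (scaleH (c i k) (f i)) (e k))"
    by (rule sum.cong)
      (use assms in \<open>auto simp: tensor_sum_right tensor_scale_left tensor_scale_right\<close>)
  also have "\<dots> = (\<Sum>k<n. \<Sum>i\<in>A. tensor (scaleH (c i k) (f i)) (e k))"
    by (rule sum.swap)
  finally show ?thesis
    by (simp add: tensor_sum_left)
qed

text \<open>By linearity \<open>Q\<close> acts on each coordinate \<open>h k\<close> separately, and
  the squared norms add up over the coordinates.\<close>

lemma norm_sum_tensor_operator_left_le:
  assumes "finite A" "bounded_operator scaleH Q" "0 \<le> C" and Q: "\<And>x. norm (Q x) \<le> C * norm x"
  shows "norm (\<Sum>i\<in>A. tensor (Q (f i)) (g i)) \<le> C * norm (\<Sum>i\<in>A. tensor (f i) (g i))"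
proof -
  obtain n e where e: "K.orthonormal n e"
    and ex: "\<And>s. s \<in> g ` A \<Longrightarrow> s = (\<Sum>k<n. scaleK (innerK s (e k)) (e k))"
    using K.orthonormal_expansion_exists[of "g ` A"] \<open>finite A\<close> by blast
  define h where "h = (\<lambda>k. \<Sum>i\<in>A. scaleH (innerK (g i) (e k)) (f i))"
  have sums: "(\<Sum>i\<in>A. tensor (f i) (g i)) = (\<Sum>k<n. tensor (h k) (e k))"
    "(\<Sum>i\<in>A. tensor (Q (f i)) (g i)) = (\<Sum>k<n. tensor (Q (h k)) (e k))"
    using ex by (subst sum_tensor_eq_orthonormal[where e = e and n = n and c = "\<lambda>i k. innerK (g i) (e k)"];
        auto simp: h_def bounded_operator_sum[OF assms(2)] bounded_operatorD[OF assms(2)])+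
  have "(norm (\<Sum>i\<in>A. tensor (Q (f i)) (g i)))\<^sup>2 \<le> (C * norm (\<Sum>i\<in>A. tensor (f i) (g i)))\<^sup>2"
    unfolding sums power_mult_distrib norm_sum_tensor_orthonormal[OF e]
    unfolding sum_distrib_left power_mult_distrib[symmetric]
    by (intro sum_mono power_mono Q) simp
  then show ?thesis
    by (rule power2_le_imp_le) (simp add: \<open>0 \<le> C\<close>)
qed

text \<open>The two factors are treated one at a time, first removing \<open>Q\<close>, then
  \<open>T\<close>.\<close>

lemma norm_sum_tensor_operator_le:
  assumes "bounded_operator scaleH Q" "bounded_operator scaleK T"
  obtains C where "\<And>(A::nat set) f g. finite A \<Longrightarrow>
    norm (\<Sum>i\<in>A. tensor (Q (f i)) (T (g i))) \<le> C * norm (\<Sum>i\<in>A. tensor (f i) (g i))"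
proof -
  interpret swap: hilbert_tensor_product scaleK innerK scaleH innerH scaleHK innerHK "\<lambda>g f. tensor f g"
    by (rule hilbert_tensor_product_swap)
  obtain C where C: "0 \<le> C" "\<And>x. norm (Q x) \<le> C * norm x"
    using bounded_operator_bound[OF assms(1)] by blast
  obtain D where D: "0 \<le> D" "\<And>x. norm (T x) \<le> D * norm x"
    using bounded_operator_bound[OF assms(2)] by blast
  have "norm (\<Sum>i\<in>A. tensor (Q (f i)) (T (g i))) \<le> (C * D) * norm (\<Sum>i\<in>A. tensor (f i) (g i))"
    if "finite A" for A :: "nat set" and f g
  proof -
    have "norm (\<Sum>i\<in>A. tensor (Q (f i)) (T (g i))) \<le> C * norm (\<Sum>i\<in>A. tensor (f i) (T (g i)))"
      by (rule norm_sum_tensor_operator_left_le[OF that assms(1) C])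
    also have "\<dots> \<le> C * (D * norm (\<Sum>i\<in>A. tensor (f i) (g i)))"
      by (intro mult_left_mono swap.norm_sum_tensor_operator_left_le[OF that assms(2) D] C)
    finally show ?thesis
      by simp
  qed
  then show ?thesis
    using that by blast
qed

text \<open>Different lists of pairs may represent the same vector, so the operator starts as a
  relation \<open>R\<close>; the norm bound makes it single-valued and density extends it.\<close>

lemma tensor_operator_exists:
  assumes Q: "bounded_operator scaleH Q" and T: "bounded_operator scaleK T"
  shows "\<exists>S. bounded_operator scaleHK S \<and> (\<forall>f g. S (tensor f g) = tensor (Q f) (T g))"
proof -
  define \<Phi> where "\<Phi> = (\<lambda>ps. \<Sum>(f, g)\<leftarrow>ps. tensor f g)"
  define \<Psi> where "\<Psi> = (\<lambda>ps. \<Sum>(f, g)\<leftarrow>ps. tensor (Q f) (T g))"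
  define R where "R = range (\<lambda>ps. (\<Phi> ps, \<Psi> ps))"
  obtain C where C: "\<And>(A::nat set) f g. finite A \<Longrightarrow>
      norm (\<Sum>i\<in>A. tensor (Q (f i)) (T (g i))) \<le> C * norm (\<Sum>i\<in>A. tensor (f i) (g i))"
    using norm_sum_tensor_operator_le[OF assms] by blast
  have scale: "scaleHK c (\<Phi> ps) = \<Phi> (map (\<lambda>(f, g). (scaleH c f, g)) ps)"
    "scaleHK c (\<Psi> ps) = \<Psi> (map (\<lambda>(f, g). (scaleH c f, g)) ps)" for c ps
    by (induction ps) (auto simp: \<Phi>_def \<Psi>_def HK.scale_right_distrib tensor_scale_left
        bounded_operatorD[OF Q])
  have add: "\<Phi> ps + \<Phi> qs = \<Phi> (ps @ qs)" "\<Psi> ps + \<Psi> qs = \<Psi> (ps @ qs)" for ps qs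
    by (auto simp: \<Phi>_def \<Psi>_def)
  have nth: "\<Phi> ps = (\<Sum>i<length ps. tensor (fst (ps ! i)) (snd (ps ! i)))"
    "\<Psi> ps = (\<Sum>i<length ps. tensor (Q (fst (ps ! i))) (T (snd (ps ! i))))" for ps
    by (auto simp: \<Phi>_def \<Psi>_def sum_list_sum_nth case_prod_beta atLeast0LessThan)
  have sub: "HK.span {tensor f g |f g. True} \<subseteq> fst ` R"
  proof (rule HK.span_minimal)
    show "{tensor f g |f g. True} \<subseteq> fst ` R"
    proof clarify
      fix f g
      have "tensor f g = \<Phi> [(f, g)]"
        by (simp add: \<Phi>_def)
      then show "tensor f g \<in> fst ` R"
        by (force simp: R_def)
    qed
    have "0 = \<Phi> []"
      by (simp add: \<Phi>_def)
    then have "0 \<in> range \<Phi>"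
      by blast
    then show "HK.subspace (fst ` R)"
      by (auto simp: R_def image_image HK.subspace_def add scale)
  qed
  obtain S where S: "bounded_operator scaleHK S" "\<And>u v. (u, v) \<in> R \<Longrightarrow> S u = v"
  proof (rule HK.bounded_operator_extension)
    show "closure (fst ` R) = UNIV"
      using closure_mono[OF sub] unfolding dense_tensor by auto
    show "norm v \<le> C * norm u" if "(u, v) \<in> R" for u v
      using that by (auto simp: R_def nth intro: C)
  qed (auto simp: R_def add scale)
  moreover have "S (tensor f g) = tensor (Q f) (T g)" for f g
  proof (rule S)
    have "(tensor f g, tensor (Q f) (T g)) = (\<Phi> [(f, g)], \<Psi> [(f, g)])"
      by (simp add: \<Phi>_def \<Psi>_def)
    then show "(tensor f g, tensor (Q f) (T g)) \<in> R"
      by (auto simp: R_def)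
  qed
  ultimately show ?thesis
    by blast
qed

lemma bounded_operator_eq_on_tensors:
  assumes S: "bounded_operator scaleHK S" "bounded_operator scaleHK S'"
    and eq: "\<And>f g. S (tensor f g) = S' (tensor f g)"
  shows "S = S'"
proof
  fix u
  let ?E = "{u. S u = S' u}"
  have "closed ?E"
    using S by (intro closed_Collect_eq linear_continuous_on HK.bounded_operator_bounded_linear)
  moreover have "HK.span {tensor f g |f g. True} \<subseteq> ?E"
  proof (rule HK.span_minimal)
    have "S 0 = 0" "S' 0 = 0"
      using S HK.bounded_operator_bounded_linear bounded_linear.linear linear_0 by blast+
    then show "HK.subspace ?E"
      by (auto simp: HK.subspace_def bounded_operatorD[OF S(1)] bounded_operatorD[OF S(2)])
  qed (auto simp: eq)
  ultimately have "closure (HK.span {tensor f g |f g. True}) \<subseteq> ?E"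
    by (rule closure_minimal[rotated])
  then show "S u = S' u"
    unfolding dense_tensor by auto
qed

lemma tensor_op:
  assumes "bounded_operator scaleH Q" "bounded_operator scaleK T"
  shows "bounded_operator scaleHK (tensor_op scaleHK tensor Q T)"
    and "tensor_op scaleHK tensor Q T (tensor f g) = tensor (Q f) (T g)"
proof -
  let ?P = "\<lambda>S. bounded_operator scaleHK S \<and> (\<forall>f g. S (tensor f g) = tensor (Q f) (T g))"
  have "\<exists>!S. ?P S"
    using tensor_operator_exists[OF assms] bounded_operator_eq_on_tensors by metis
  then have "?P (tensor_op scaleHK tensor Q T)"
    unfolding tensor_op_def by (rule theI')
  then show "bounded_operator scaleHK (tensor_op scaleHK tensor Q T)"
    and "tensor_op scaleHK tensor Q T (tensor f g) = tensor (Q f) (T g)"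
    by auto
qed

end

subsection \<open>Unconditional convergence of tensor products of series\<close>

text \<open>A subsum outside \<open>F\<close> is the difference of two partial sums containing
  \<open>F\<close>, both within half of \<open>\<delta>\<close> of the limit.\<close>

lemma has_sum_finite_tails:
  fixes x :: "'i \<Rightarrow> 'a::real_normed_vector"
  assumes "(x has_sum f) I" "\<delta> > 0"
  obtains F where "finite F" "F \<subseteq> I" "norm (sum x F - f) \<le> \<delta>"
    "\<And>A. finite A \<Longrightarrow> A \<subseteq> I - F \<Longrightarrow> norm (sum x A) \<le> \<delta>"
proof -
  have "eventually (\<lambda>F. dist (sum x F) f < \<delta> / 2) (finite_subsets_at_top I)"
    using tendstoD[OF assms(1)[unfolded has_sum_def], of "\<delta> / 2"] assms(2) by simp
  then obtain F where F: "finite F" "F \<subseteq> I"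
    and near: "\<And>Y. finite Y \<Longrightarrow> F \<subseteq> Y \<Longrightarrow> Y \<subseteq> I \<Longrightarrow> norm (sum x Y - f) < \<delta> / 2"
    by (auto simp: eventually_finite_subsets_at_top dist_norm)
  have "norm (sum x A) \<le> \<delta>" if A: "finite A" "A \<subseteq> I - F" for A
  proof -
    have "sum x (F \<union> A) = sum x F + sum x A"
      using A F by (intro sum.union_disjoint) auto
    then have "sum x A = (sum x (F \<union> A) - f) - (sum x F - f)"
      by simp
    also have "norm \<dots> \<le> norm (sum x (F \<union> A) - f) + norm (sum x F - f)"
      by (rule norm_triangle_ineq4)
    also have "\<dots> \<le> \<delta> / 2 + \<delta> / 2"
      using near[of "F \<union> A"] near[of F] A F by (intro add_mono less_imp_le) auto
    finally show ?thesis
      by simp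
  qed
  then show ?thesis
    using that[of F] F near[of F] assms(2) by auto
qed

lemma has_sum_finite_sums_bounded:
  fixes x :: "'i \<Rightarrow> 'a::real_normed_vector"
  assumes "(x has_sum f) I"
  obtains B where "0 \<le> B" "\<And>A. finite A \<Longrightarrow> A \<subseteq> I \<Longrightarrow> norm (sum x A) \<le> B"
proof -
  obtain F where F: "finite F" "F \<subseteq> I" "norm (sum x F - f) \<le> 1"
    and tail: "\<And>A. finite A \<Longrightarrow> A \<subseteq> I - F \<Longrightarrow> norm (sum x A) \<le> 1"
    using has_sum_finite_tails[OF assms zero_less_one] by blast
  have "norm (sum x A) \<le> 1 + (\<Sum>i\<in>F. norm (x i))" if A: "finite A" "A \<subseteq> I" for A
  proof -
    have "sum x A = sum x (A - F) + sum x (A \<inter> F)"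
      using sum.Int_Diff[of A x F] A by (simp add: add.commute)
    also have "norm \<dots> \<le> 1 + (\<Sum>i\<in>A \<inter> F. norm (x i))"
      using A by (intro order_trans[OF norm_triangle_ineq] add_mono tail norm_sum) auto
    also have "\<dots> \<le> 1 + (\<Sum>i\<in>F. norm (x i))"
      using F by (intro add_left_mono sum_mono2) auto
    finally show ?thesis .
  qed
  then show ?thesis
    using that[of "1 + (\<Sum>i\<in>F. norm (x i))"] by (simp add: sum_nonneg)
qed

context hilbert_tensor_product
begin

text \<open>Grouping \<open>G\<close> by first index gives right factors \<open>z i\<close> of norm
  at most \<open>b\<close>; their orthonormal coordinates divided by \<open>b\<close> are weights
  for \<open>little_Grothendieck\<close>.\<close>

lemma norm_sum_tensor_pairs_le:
  assumes fin: "finite F" "finite E" and G: "G \<subseteq> F \<times> E"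
    and a: "\<And>A. A \<subseteq> F \<Longrightarrow> norm (sum x A) \<le> a" and b: "\<And>B. B \<subseteq> E \<Longrightarrow> norm (sum y B) \<le> b"
  shows "norm (\<Sum>(i, j)\<in>G. tensor (x i) (y j)) \<le> 36 * a * b"
proof -
  have ab: "0 \<le> a" "0 \<le> b"
    using a[of "{}"] b[of "{}"] by auto
  define z where "z = (\<lambda>i. \<Sum>j\<in>{j \<in> E. (i, j) \<in> G}. y j)"
  have "(\<Sum>(i, j)\<in>G. tensor (x i) (y j)) = (\<Sum>i\<in>F. \<Sum>j\<in>{j \<in> E. (i, j) \<in> G}. tensor (x i) (y j))"
    using fin G by (subst sum.Sigma) (auto intro!: sum.cong)
  then have G_eq: "(\<Sum>(i, j)\<in>G. tensor (x i) (y j)) = (\<Sum>i\<in>F. tensor (x i) (z i))"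
    by (simp add: z_def tensor_sum_right)
  have zb: "norm (z i) \<le> b" for i
    unfolding z_def by (rule b) auto
  show ?thesis
  \<comment> \<open>The weights below divide by \<open>b\<close>.\<close>
  proof (cases "b = 0")
    case True
    then have "z i = 0" for i
      using zb[of i] by simp
    then have "tensor (x i) (z i) = 0" for i
      using norm_tensor[of "x i" "z i"] by simp
    then show ?thesis
      using G_eq True by simp
  next
    case False
    then have "b > 0"
      using ab by simp
    obtain n e where e: "K.orthonormal n e"
      and "\<And>s. s \<in> z ` F \<Longrightarrow> s = (\<Sum>k<n. scaleK (innerK s (e k)) (e k))"
      using K.orthonormal_expansion_exists[of "z ` F"] fin by blast
    then have ex: "\<And>i. i \<in> F \<Longrightarrow> z i = (\<Sum>k<n. scaleK (innerK (z i) (e k)) (e k))"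
      by blast
    define w where "w = (\<lambda>i k. (1 / b) *\<^sub>R innerK (z i) (e k))"
    have bw: "innerK (z i) (e k) = b *\<^sub>R w i k" for i k
      using \<open>b > 0\<close> by (simp add: w_def)
    have little: "(\<Sum>k<n. (norm (\<Sum>i\<in>F. scaleH (w i k) (x i)))\<^sup>2) \<le> 80 * (4 * a)\<^sup>2"
    proof (rule H.little_Grothendieck[OF fin(1)])
      show "norm (\<Sum>i\<in>F. scaleH (c i) (x i)) \<le> 4 * a" if "\<And>i. i \<in> F \<Longrightarrow> norm (c i) \<le> 1" for c
        by (rule H.norm_scalar_multipliers_le[OF fin(1) a that])
      fix i assume i: "i \<in> F"
      have "(norm (z i))\<^sup>2 = (\<Sum>k<n. (norm (innerK (z i) (e k)))\<^sup>2)"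
        using K.norm_sum_orthonormal[OF e, of "\<lambda>k. innerK (z i) (e k)"] ex[OF i] by simp
      also have "\<dots> = b\<^sup>2 * (\<Sum>k<n. (norm (w i k))\<^sup>2)"
        unfolding bw by (simp add: power_mult_distrib sum_distrib_left)
      finally have "b\<^sup>2 * (\<Sum>k<n. (norm (w i k))\<^sup>2) \<le> b\<^sup>2 * 1"
        using power_mono[OF zb[of i], of 2] by simp
      then show "(\<Sum>k<n. (norm (w i k))\<^sup>2) \<le> 1"
        using \<open>b > 0\<close> by (subst (asm) mult_le_cancel_left_pos) auto
    qed simp
    have "(norm (\<Sum>(i, j)\<in>G. tensor (x i) (y j)))\<^sup>2
        = (\<Sum>k<n. (norm (\<Sum>i\<in>F. scaleH (b *\<^sub>R w i k) (x i)))\<^sup>2)"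
      using sum_tensor_eq_orthonormal[OF ex, where A = F and f = x] norm_sum_tensor_orthonormal[OF e]
      by (simp add: G_eq bw)
    also have "\<dots> = b\<^sup>2 * (\<Sum>k<n. (norm (\<Sum>i\<in>F. scaleH (w i k) (x i)))\<^sup>2)"
      by (simp add: power_mult_distrib sum_distrib_left flip: H.scaleR_scale scaleR_sum_right)
    also have "\<dots> \<le> b\<^sup>2 * (80 * (4 * a)\<^sup>2)"
      by (intro mult_left_mono little) simp
    also have "\<dots> = 1280 * (a\<^sup>2 * b\<^sup>2)"
      by (simp add: power_mult_distrib)
    \<comment> \<open>Rounding \<open>80 * 4\<^sup>2 = 1280\<close> up to the square of 36.\<close>
    also have "\<dots> \<le> 1296 * (a\<^sup>2 * b\<^sup>2)"
      by (intro mult_right_mono) auto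
    also have "\<dots> = (36 * a * b)\<^sup>2"
      by (simp add: power_mult_distrib)
    finally show ?thesis
      by (rule power2_le_imp_le) (use ab in simp)
  qed
qed

text \<open>A finite \<open>G\<close> containing \<open>F \<times> E\<close> is that rectangle,
  where the sum factorises, plus two remainders of arbitrary shape with one index in a tail.\<close>

lemma has_sum_tensor:
  assumes x: "(x has_sum f) I" and y: "(y has_sum g) J"
  shows "((\<lambda>(i, j). tensor (x i) (y j)) has_sum tensor f g) (I \<times> J)"
  unfolding has_sum_def tendsto_iff eventually_finite_subsets_at_top
proof (intro allI impI)
  fix \<epsilon> :: real assume "\<epsilon> > 0"
  obtain a where a: "0 \<le> a" "\<And>A. finite A \<Longrightarrow> A \<subseteq> I \<Longrightarrow> norm (sum x A) \<le> a"
    using has_sum_finite_sums_bounded[OF x] by blast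
  obtain b where b: "0 \<le> b" "\<And>A. finite A \<Longrightarrow> A \<subseteq> J \<Longrightarrow> norm (sum y A) \<le> b"
    using has_sum_finite_sums_bounded[OF y] by blast
  \<comment> \<open>\<open>M\<close> collects the coefficients of \<open>\<delta>\<close> in the
    four error terms.\<close>
  define M where "M = 36 * b + 36 * a + norm g + a"
  have M: "0 \<le> M"
    using a(1) b(1) by (simp add: M_def)
  define \<delta> where "\<delta> = \<epsilon> / (M + 1)"
  have \<delta>: "\<delta> > 0" "\<delta> * M < \<epsilon>"
    using \<open>\<epsilon> > 0\<close> M by (auto simp: \<delta>_def field_simps)
  obtain F where F: "finite F" "F \<subseteq> I" "norm (sum x F - f) \<le> \<delta>"
    "\<And>A. finite A \<Longrightarrow> A \<subseteq> I - F \<Longrightarrow> norm (sum x A) \<le> \<delta>"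
    using has_sum_finite_tails[OF x \<delta>(1)] by blast
  obtain E where E: "finite E" "E \<subseteq> J" "norm (sum y E - g) \<le> \<delta>"
    "\<And>A. finite A \<Longrightarrow> A \<subseteq> J - E \<Longrightarrow> norm (sum y A) \<le> \<delta>"
    using has_sum_finite_tails[OF y \<delta>(1)] by blast
  let ?h = "\<lambda>(i, j). tensor (x i) (y j)"
  have "dist (sum ?h G) (tensor f g) < \<epsilon>" if G: "finite G" "F \<times> E \<subseteq> G" "G \<subseteq> I \<times> J" for G
  proof -
    \<comment> \<open>On \<open>G1\<close> the subsums of \<open>x\<close> are at most
      \<open>\<delta>\<close> and those of \<open>y\<close> at most \<open>b\<close>; on
      \<open>G2\<close> the bounds are \<open>a\<close> and \<open>\<delta>\<close>.\<close>
    define G1 where "G1 = {p \<in> G. fst p \<notin> F}"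
    define G2 where "G2 = {p \<in> G. fst p \<in> F \<and> snd p \<notin> E}"
    have "G = (F \<times> E) \<union> (G1 \<union> G2)" "finite G1" "finite G2" "G1 \<inter> G2 = {}"
      "(F \<times> E) \<inter> (G1 \<union> G2) = {}"
      using G by (auto simp: G1_def G2_def)
    then have split: "sum ?h G = sum ?h (F \<times> E) + (sum ?h G1 + sum ?h G2)"
      using F(1) E(1) by (simp add: sum.union_disjoint)
    have main: "sum ?h (F \<times> E) = tensor (sum x F) (sum y E)"
      unfolding tensor_sum_left unfolding tensor_sum_right by (simp add: sum.cartesian_product)
    have fin: "finite (fst ` G1)" "finite (snd ` G1)" "finite (snd ` G2)"
      using G(1) by (auto simp: G1_def G2_def)
    have sub: "fst ` G1 \<subseteq> I - F" "snd ` G1 \<subseteq> J" "snd ` G2 \<subseteq> J - E"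
      using G(3) by (auto simp: G1_def G2_def)
    have 1: "norm (sum ?h G1) \<le> 36 * \<delta> * b"
    proof (rule norm_sum_tensor_pairs_le[OF fin(1,2)])
      show "norm (sum x A) \<le> \<delta>" if "A \<subseteq> fst ` G1" for A
        using that fin(1) sub(1) by (intro F(4)) (auto intro: finite_subset)
      show "norm (sum y A) \<le> b" if "A \<subseteq> snd ` G1" for A
        using that fin(2) sub(2) by (intro b(2)) (auto intro: finite_subset)
    qed (force simp: image_iff)
    have 2: "norm (sum ?h G2) \<le> 36 * a * \<delta>"
    proof (rule norm_sum_tensor_pairs_le[OF F(1) fin(3)])
      show "norm (sum x A) \<le> a" if "A \<subseteq> F" for A
        using that F(1,2) by (intro a(2)) (auto intro: finite_subset)
      show "norm (sum y A) \<le> \<delta>" if "A \<subseteq> snd ` G2" for A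
        using that fin(3) sub(3) by (intro E(4)) (auto intro: finite_subset)
    qed (force simp: image_iff G2_def)
    have "tensor (sum x F) (sum y E) - tensor f g
        = tensor (sum x F - f) g + tensor (sum x F) (sum y E - g)"
      by (simp add: tensor_diff_left tensor_diff_right)
    also have "norm \<dots> \<le> norm (sum x F - f) * norm g + norm (sum x F) * norm (sum y E - g)"
      by (rule order_trans[OF norm_triangle_ineq]) (simp add: norm_tensor)
    also have "\<dots> \<le> \<delta> * norm g + a * \<delta>"
      using F E a \<delta>(1) by (intro add_mono mult_mono) auto
    finally have 3: "norm (tensor (sum x F) (sum y E) - tensor f g) \<le> \<delta> * norm g + a * \<delta>" .
    have "sum ?h G - tensor f g = (tensor (sum x F) (sum y E) - tensor f g) + (sum ?h G1 + sum ?h G2)"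
      by (simp add: split main)
    also have "norm \<dots> \<le> (\<delta> * norm g + a * \<delta>) + (36 * \<delta> * b + 36 * a * \<delta>)"
      by (intro norm_triangle_le add_mono 1 2 3)
    also have "\<dots> = \<delta> * M"
      by (simp add: M_def algebra_simps)
    finally show ?thesis
      using \<delta>(2) by (simp add: dist_norm)
  qed
  then show "\<exists>X. finite X \<and> X \<subseteq> I \<times> J \<and>
      (\<forall>Y. finite Y \<and> X \<subseteq> Y \<and> Y \<subseteq> I \<times> J \<longrightarrow> dist (sum ?h Y) (tensor f g) < \<epsilon>)"
    using F(1,2) E(1,2) by (intro exI[of _ "F \<times> E"]) auto
qed

end

theorem proposition3p10:
  fixes scaleH :: "'s::hilbert_scalar \<Rightarrow> 'h::banach \<Rightarrow> 'h" and innerH :: "'h \<Rightarrow> 'h \<Rightarrow> 's"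
    and scaleK :: "'s \<Rightarrow> 'k::banach \<Rightarrow> 'k" and innerK :: "'k \<Rightarrow> 'k \<Rightarrow> 's"
    and scaleHK :: "'s \<Rightarrow> 'hk::banach \<Rightarrow> 'hk" and innerHK :: "'hk \<Rightarrow> 'hk \<Rightarrow> 's"
    and tensor :: "'h \<Rightarrow> 'k \<Rightarrow> 'hk"
    and I :: "'i set" and T :: "'i \<Rightarrow> 'h \<Rightarrow> 'h"
    and J :: "'j set" and U :: "'j \<Rightarrow> 'k \<Rightarrow> 'k"
  assumes "hilbert_tensor_product scaleH innerH scaleK innerK scaleHK innerHK tensor"
    and "separable_space (euclidean :: 'h topology)"
    and "separable_space (euclidean :: 'k topology)"
    and "resolution_of_identity scaleH I T"
    and "resolution_of_identity scaleK J U"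
  shows "tensor_resolution_of_identity scaleHK tensor (I \<times> J)
    (\<lambda>(i, j). tensor_op scaleHK tensor (T i) (U j))"
proof -
  interpret hilbert_tensor_product scaleH innerH scaleK innerK scaleHK innerHK tensor
    by fact
  have T: "\<And>i. i \<in> I \<Longrightarrow> bounded_operator scaleH (T i)" "\<And>f. ((\<lambda>i. T i f) has_sum f) I"
    and U: "\<And>j. j \<in> J \<Longrightarrow> bounded_operator scaleK (U j)" "\<And>g. ((\<lambda>j. U j g) has_sum g) J"
    using assms(4,5) by (auto simp: resolution_of_identity_def)
  \<comment> \<open>On simple tensors the operators act factorwise, so this is the product of the
    two given series.\<close>
  have "((\<lambda>p. (case p of (i, j) \<Rightarrow> tensor_op scaleHK tensor (T i) (U j)) (tensor f g))
      has_sum tensor f g) (I \<times> J)" for f g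
    using has_sum_tensor[OF T(2) U(2), of f g]
    by (rule has_sum_cong[THEN iffD2, rotated]) (auto simp: tensor_op(2) T(1) U(1))
  then show ?thesis
    unfolding tensor_resolution_of_identity_def using T(1) U(1) by (auto intro: tensor_op(1))
qed

end
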